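(* Fix $p\in(0,1]$. As $n\to\infty$, \[\mathcal E(\mathrm{Tam}_n)\leq \frac{2}{p}\left(\sqrt{\overline\rho_p(1+\overline\rho_p)}-\overline\rho_p\right)n+o(n).\]
   Context: $\mathrm{Tam}_n$ is the $n$-th Tamari lattice, realized as the set $\mathrm{Av}_n(312)$ of permutations $x\in S_n$ with no indices $i_1<i_2<i_3$ satisfying $x(i_2)<x(i_3)<x(i_1)$, ordered by the (right) weak order on $S_n$ (it is a sublattice of the weak order). For a finite lattice $L$, the Ungarian Markov chain (probability $p$) moves from $x$ to $\bigwedge(\{x\}\cup T)$, where $T$ contains each element covered by $x$ independently with probability $p$; $\mathcal E(L)$ is the expected number of steps from the top element to the bottom element. Define $\Upsilon_p(x)=px\sum_{k\in\mathbb Z}(1-p)^ke^{-(1-p)^kx}$ if $p<1$ and $\Upsilon_p(x)=0$ if $p=1$, and $\overline\rho_p=\max_{0<x<1}\Upsilon_p(x)$. *)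

theory Defs
  imports
    "HOL-Probability.Probability"
    "HOL-Algebra.Lattice"
    "HOL-Combinatorics.Permutations"
    "HOL-Library.Landau_Symbols"
begin

definition lower_covers :: "'a gorder \<Rightarrow> 'a \<Rightarrow> 'a set" where
  "lower_covers L x =
     {y \<in> carrier L. y \<sqsubset>\<^bsub>L\<^esub> x \<and> \<not> (\<exists>z \<in> carrier L. y \<sqsubset>\<^bsub>L\<^esub> z \<and> z \<sqsubset>\<^bsub>L\<^esub> x)}"

text \<open>
  The chain is driven by independent coins, each showing \<^const>\<open>True\<close> with probability \<open>p\<close>: the
  coin indexed by \<open>(k, y)\<close> decides whether \<open>y\<close> belongs to the random set \<open>T\<close> in the step from time
  \<open>k\<close> to time \<open>k + 1\<close>. Only the coins of the elements covered by the current state are used,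
  and no coin is used at two different times, so \<open>ungarian_chain L\<close> is a Markov chain
  with the Ungarian transition probabilities.
\<close>

definition ungarian_coins :: "real \<Rightarrow> 'a gorder \<Rightarrow> (nat \<times> 'a \<Rightarrow> bool) measure" where
  "ungarian_coins p L = PiM (UNIV \<times> carrier L) (\<lambda>_. measure_pmf (bernoulli_pmf p))"

fun ungarian_chain :: "'a gorder \<Rightarrow> (nat \<times> 'a \<Rightarrow> bool) \<Rightarrow> nat \<Rightarrow> 'a" where
  "ungarian_chain L \<omega> 0 = \<top>\<^bsub>L\<^esub>"
| "ungarian_chain L \<omega> (Suc k) =
     (let x = ungarian_chain L \<omega> k; T = {y \<in> lower_covers L x. \<omega> (k, y)}
      in \<Sqinter>\<^bsub>L\<^esub>({x} \<union> T))"

text \<open>The number of steps is \<open>\<infinity>\<close> if the bottom element is never reached.\<close>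

definition ungarian_steps :: "'a gorder \<Rightarrow> (nat \<times> 'a \<Rightarrow> bool) \<Rightarrow> ennreal" where
  "ungarian_steps L \<omega> = (INF k \<in> {k. ungarian_chain L \<omega> k = \<bottom>\<^bsub>L\<^esub>}. of_nat k)"

definition ungarian_expectation :: "real \<Rightarrow> 'a gorder \<Rightarrow> ennreal" where
  "ungarian_expectation p L = (\<integral>\<^sup>+ \<omega>. ungarian_steps L \<omega> \<partial>ungarian_coins p L)"

text \<open>
  Inversions are recorded as pairs of values, not of positions. Containment of these sets is the
  right weak order, whose covering relations swap adjacent entries of the one-line notation.
\<close>

definition inversions :: "nat \<Rightarrow> (nat \<Rightarrow> nat) \<Rightarrow> (nat \<times> nat) set" where
  "inversions n x = {(x i, x j) | i j. i \<in> {1..n} \<and> j \<in> {1..n} \<and> i < j \<and> x i > x j}"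

definition right_weak_le :: "nat \<Rightarrow> (nat \<Rightarrow> nat) \<Rightarrow> (nat \<Rightarrow> nat) \<Rightarrow> bool" where
  "right_weak_le n x y \<longleftrightarrow> inversions n x \<subseteq> inversions n y"

definition Av312 :: "nat \<Rightarrow> (nat \<Rightarrow> nat) set" where
  "Av312 n = {x. x permutes {1..n} \<and>
     \<not> (\<exists>i\<^sub>1 \<in> {1..n}. \<exists>i\<^sub>2 \<in> {1..n}. \<exists>i\<^sub>3 \<in> {1..n}.
          i\<^sub>1 < i\<^sub>2 \<and> i\<^sub>2 < i\<^sub>3 \<and> x i\<^sub>2 < x i\<^sub>3 \<and> x i\<^sub>3 < x i\<^sub>1)}"

definition Tam :: "nat \<Rightarrow> (nat \<Rightarrow> nat) gorder" where
  "Tam n = \<lparr>carrier = Av312 n, eq = (=), le = right_weak_le n\<rparr>"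

definition Upsilon :: "real \<Rightarrow> real \<Rightarrow> real" where
  "Upsilon p x =
     (if p < 1
      then p * x * (\<Sum>\<^sub>\<infinity>k\<in>(UNIV :: int set). (1 - p) powi k * exp (- ((1 - p) powi k * x)))
      else 0)"

text \<open>
  The maximum over the open interval is attained for \<open>p \<in> {0<..1}\<close>, because
  \<open>Upsilon p\<close> is continuous and satisfies \<open>Upsilon p ((1 - p) * x) = Upsilon p x\<close> when \<open>p < 1\<close>.
\<close>

definition rho_bar :: "real \<Rightarrow> real" where
  "rho_bar p = (GREATEST r. \<exists>x. 0 < x \<and> x < 1 \<and> r = Upsilon p x)"

end

theory Submission
  imports Defs "HOL-Real_Asymp.Real_Asymp"
begin

text \<open>
  A 312-avoiding permutation is encoded by the vector \<open>v\<close> for which \<open>(b, a)\<close> is an inversion iff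
  \<open>a < b \<le> v a\<close>. In these coordinates meets are pointwise minima and each \<open>a\<close> with \<open>a < v a\<close>
  contributes one lower cover, so a step of the chain lowers every row \<open>a\<close> independently with
  probability \<open>p\<close>.

  All rows start at \<open>n\<close>. If a row \<open>c\<close> first succeeds no later than a row \<open>A > c\<close>, its first success
  already takes it below \<open>A\<close>, after which \<open>A - c\<close> successes in total finish it. Let \<open>A\<close> be the row
  with the latest first success and \<open>B\<close> the one among the rows \<open>c < A\<close>, ties being broken by a
  uniformly random permutation. By exchangeability \<open>A\<close> is uniform on \<open>{1..n}\<close> and \<open>B\<close> is uniform
  below \<open>A\<close>, and up to \<open>O(1)\<close> every row needs at most \<open>max (n - A) (max (A - B) B)\<close> successes, whose
  mean is at most \<open>2 n / 3 + O(1)\<close>. Hoeffding's inequality bounds the expected number of steps by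
  \<open>2 n / (3 p) + o(n)\<close>.

  Finally \<open>rho_bar p \<ge> Upsilon p 1 \<ge> 1 / e > 1 / 3\<close> for \<open>p < 1\<close>, and
  \<open>2 (sqrt (r (1 + r)) - r) \<ge> 2 / 3\<close> for \<open>r \<ge> 1 / 3\<close>. For \<open>p = 1\<close> the chain stops after one step.
\<close>

section \<open>Bracket vectors of 312-avoiding permutations\<close>

lemma inversions_permutes_iff:
  assumes "x permutes {1..n}"
  shows "(b, a) \<in> inversions n x \<longleftrightarrow> a \<in> {1..n} \<and> b \<in> {1..n} \<and> a < b \<and> inv x b < inv x a"
proof
  assume "(b, a) \<in> inversions n x"
  then obtain i j where ij: "b = x i" "a = x j" "i \<in> {1..n}" "j \<in> {1..n}" "i < j" "x i > x j"
    unfolding inversions_def by blast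
  moreover have "inv x (x i) = i" "inv x (x j) = j"
    using permutes_inverses(2)[OF assms] by auto
  ultimately show "a \<in> {1..n} \<and> b \<in> {1..n} \<and> a < b \<and> inv x b < inv x a"
    using permutes_in_image[OF assms] by metis
next
  assume *: "a \<in> {1..n} \<and> b \<in> {1..n} \<and> a < b \<and> inv x b < inv x a"
  have "b = x (inv x b)" "a = x (inv x a)"
    using permutes_inverses(1)[OF assms] by auto
  moreover have "inv x b \<in> {1..n}" "inv x a \<in> {1..n}"
    using permutes_in_image[OF permutes_inv[OF assms]] * by blast+
  ultimately show "(b, a) \<in> inversions n x"
    unfolding inversions_def using * by (intro CollectI exI[of _ "inv x b"] exI[of _ "inv x a"]) auto
qed

text \<open>The value at \<open>b\<close> is the rank of \<open>b\<close> in the order induced by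
  \<open>\<sigma>\<close>, so a permutation can be recovered from comparisons of its values
  alone.\<close>

lemma card_le_atLeastAtMost:
  assumes "\<sigma> permutes {1..n}" "b \<in> {1..n}"
  shows "card {c \<in> {1..n}. \<sigma> c \<le> \<sigma> b} = \<sigma> b"
proof -
  have "bij_betw \<sigma> {c \<in> {1..n}. \<sigma> c \<le> \<sigma> b} {1..\<sigma> b}"
  proof (rule bij_betw_imageI)
    show "inj_on \<sigma> {c \<in> {1..n}. \<sigma> c \<le> \<sigma> b}"
      by (metis assms(1) inj_on_subset permutes_inj subset_UNIV)
    show "\<sigma> ` {c \<in> {1..n}. \<sigma> c \<le> \<sigma> b} = {1..\<sigma> b}"
    proof
      show "\<sigma> ` {c \<in> {1..n}. \<sigma> c \<le> \<sigma> b} \<subseteq> {1..\<sigma> b}"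
      proof
        fix m assume "m \<in> \<sigma> ` {c \<in> {1..n}. \<sigma> c \<le> \<sigma> b}"
        then obtain c where "c \<in> {1..n}" "m = \<sigma> c" "\<sigma> c \<le> \<sigma> b" by blast
        moreover from this have "\<sigma> c \<in> {1..n}"
          using permutes_in_image[OF assms(1)] by blast
        ultimately show "m \<in> {1..\<sigma> b}" by simp
      qed
      show "{1..\<sigma> b} \<subseteq> \<sigma> ` {c \<in> {1..n}. \<sigma> c \<le> \<sigma> b}"
      proof
        fix m assume m: "m \<in> {1..\<sigma> b}"
        have "\<sigma> b \<in> {1..n}" using permutes_in_image[OF assms(1), of b] assms(2) by blast
        with m have "m \<in> {1..n}" by simp
        then obtain c where "c \<in> {1..n}" "m = \<sigma> c"
          using permutes_image[OF assms(1)] by blast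
        with m show "m \<in> \<sigma> ` {c \<in> {1..n}. \<sigma> c \<le> \<sigma> b}" by auto
      qed
    qed
  qed
  then show ?thesis using bij_betw_same_card by fastforce
qed

text \<open>The inversion set decides, for any two values, which of them stands first. This fixes
  the rank of the position of every value, and with it \<open>inv x\<close>.\<close>

lemma inversions_inject:
  assumes x: "x permutes {1..n}" and y: "y permutes {1..n}"
    and eq: "inversions n x = inversions n y"
  shows "x = y"
proof -
  have *: "inv x c \<le> inv x b \<longleftrightarrow> inv y c \<le> inv y b" if "c \<in> {1..n}" "b \<in> {1..n}" for b c
  proof -
    have injx: "inv x c = inv x b \<longleftrightarrow> c = b" and injy: "inv y c = inv y b \<longleftrightarrow> c = b"
      by (rule inj_eq[OF permutes_inj[OF permutes_inv[OF x]]],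
          rule inj_eq[OF permutes_inj[OF permutes_inv[OF y]]])
    have "(b, c) \<in> inversions n x \<longleftrightarrow> (b, c) \<in> inversions n y"
         "(c, b) \<in> inversions n x \<longleftrightarrow> (c, b) \<in> inversions n y"
      using eq by auto
    then show ?thesis
      unfolding inversions_permutes_iff[OF x] inversions_permutes_iff[OF y]
      using that injx injy by (cases b c rule: linorder_cases) (auto simp: not_less le_less)
  qed
  have "inv x b = inv y b" for b
  proof (cases "b \<in> {1..n}")
    case True
    have "inv x b = card {c \<in> {1..n}. inv x c \<le> inv x b}"
      using card_le_atLeastAtMost[OF permutes_inv[OF x] True] by simp
    also have "{c \<in> {1..n}. inv x c \<le> inv x b} = {c \<in> {1..n}. inv y c \<le> inv y b}"
      using * True by auto
    also have "card \<dots> = inv y b"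
      using card_le_atLeastAtMost[OF permutes_inv[OF y] True] by simp
    finally show ?thesis .
  next
    case False
    then show ?thesis
      using permutes_not_in[OF permutes_inv[OF x]] permutes_not_in[OF permutes_inv[OF y]] by simp
  qed
  then have "inv x = inv y" by auto
  then show ?thesis
    by (metis permutes_inv_inv x y)
qed

text \<open>Bracket vectors in the sense of Huang and Tamari, storing the right end
  \<open>v a\<close> of an interval instead of its length. The last condition makes the intervals
  \<open>{a..v a}\<close> pairwise nested or disjoint. With \<open>v a = a\<close> outside
  \<open>{1..n}\<close>, the pointwise order on functions is the comparison of the entries in
  \<open>{1..n}\<close>.\<close>

definition bracket_vectors :: "nat \<Rightarrow> (nat \<Rightarrow> nat) set" where
  "bracket_vectors n = {v. (\<forall>a. a \<notin> {1..n} \<longrightarrow> v a = a) \<and>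
     (\<forall>a\<in>{1..n}. a \<le> v a \<and> v a \<le> n \<and> (\<forall>j\<in>{a..v a}. v j \<le> v a))}"

definition bracket :: "nat \<Rightarrow> (nat \<Rightarrow> nat) \<Rightarrow> nat \<Rightarrow> nat" where
  "bracket n x a = a + card {b. (b, a) \<in> inversions n x}"

lemma Av312D:
  assumes "x \<in> Av312 n" "i \<in> {1..n}" "j \<in> {1..n}" "k \<in> {1..n}"
    "i < j" "j < k" "x j < x k" "x k < x i"
  shows False
  using assms unfolding Av312_def by blast

text \<open>Avoiding 312 leaves no gap among the larger values to the left of \<open>a\<close>: if
  \<open>c\<close> stands before \<open>a\<close> while some \<open>b\<close> with
  \<open>a < b < c\<close> stands after \<open>a\<close>, then \<open>c\<close>, \<open>a\<close>,
  \<open>b\<close> form the pattern 312. So these values are an interval starting at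
  \<open>a + 1\<close>, which is determined by its cardinality.\<close>

lemma inversions_Av312_iff:
  assumes "x \<in> Av312 n"
  shows "(b, a) \<in> inversions n x \<longleftrightarrow> a \<in> {1..n} \<and> a < b \<and> b \<le> bracket n x a"
proof -
  have x: "x permutes {1..n}"
    using assms by (simp add: Av312_def)
  define B where "B = {b. (b, a) \<in> inversions n x}"
  have B: "b \<in> B \<longleftrightarrow> a \<in> {1..n} \<and> b \<in> {1..n} \<and> a < b \<and> inv x b < inv x a" for b
    unfolding B_def using inversions_permutes_iff[OF x] by auto
  have fin: "finite B"
    by (rule finite_subset[of _ "{1..n}"]) (auto simp: B)
  have down: "b \<in> B" if "c \<in> B" "a < b" "b < c" for b c
  proof (rule ccontr)
    assume "b \<notin> B"
    with that have "\<not> inv x b < inv x a" "a \<in> {1..n}" "c \<in> {1..n}" "b \<in> {1..n}" "inv x c < inv x a"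
      by (auto simp: B)
    moreover have "inv x b \<noteq> inv x a"
      using inj_eq[OF permutes_inj[OF permutes_inv[OF x]]] that by auto
    ultimately have "inv x c < inv x a" "inv x a < inv x b" by auto
    moreover have "inv x c \<in> {1..n}" "inv x a \<in> {1..n}" "inv x b \<in> {1..n}"
      using permutes_in_image[OF permutes_inv[OF x]] \<open>a \<in> {1..n}\<close> \<open>c \<in> {1..n}\<close> \<open>b \<in> {1..n}\<close> by blast+
    moreover have "x (inv x a) = a" "x (inv x b) = b" "x (inv x c) = c"
      using permutes_inverses(1)[OF x] by auto
    ultimately show False
      using Av312D[OF assms, of "inv x c" "inv x a" "inv x b"] \<open>a < b\<close> \<open>b < c\<close> by simp
  qed
  define m where "m = Max (insert a B)"
  have "B = {a<..m}"
  proof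
    show "B \<subseteq> {a<..m}"
      unfolding m_def using fin by (auto simp: B)
    show "{a<..m} \<subseteq> B"
    proof
      fix b assume b: "b \<in> {a<..m}"
      have "m \<in> insert a B"
        unfolding m_def using fin by (intro Max_in) auto
      with b show "b \<in> B" using down[of m b] by (cases "b = m") auto
    qed
  qed
  moreover have "bracket n x a = a + card {a<..m}"
    unfolding bracket_def B_def[symmetric] using \<open>B = {a<..m}\<close> by simp
  moreover have "a \<le> m" unfolding m_def using fin by auto
  ultimately have "b \<in> B \<longleftrightarrow> a < b \<and> b \<le> bracket n x a" by auto
  then show ?thesis
    using B[of b] unfolding B_def by auto
qed

text \<open>Nestedness is transitivity of inversions: if \<open>bracket n x j\<close> stands before
  \<open>j\<close> and \<open>j\<close> before \<open>a\<close>, then \<open>bracket n x j\<close>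
  stands before \<open>a\<close>.\<close>

lemma bracket_mem:
  assumes "x \<in> Av312 n"
  shows "bracket n x \<in> bracket_vectors n"
proof -
  have x: "x permutes {1..n}"
    using assms by (simp add: Av312_def)
  note iff = inversions_Av312_iff[OF assms] and iff' = inversions_permutes_iff[OF x]
  have "bracket n x a = a" if "a \<notin> {1..n}" for a
  proof -
    have "{b. (b, a) \<in> inversions n x} = {}" using that by (auto simp: iff')
    then show ?thesis by (simp add: bracket_def)
  qed
  moreover have ge: "a \<le> bracket n x a" for a by (simp add: bracket_def)
  moreover have le: "bracket n x a \<le> n" if "a \<in> {1..n}" for a
    using iff[of "bracket n x a" a] iff'[of "bracket n x a" a] ge[of a] that
    by (cases "bracket n x a = a") auto
  moreover have "bracket n x j \<le> bracket n x a"
    if "a \<in> {1..n}" "j \<in> {a..bracket n x a}" for a j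
  proof (cases "j = a \<or> bracket n x j = j")
    case False
    with that ge[of j] have "(bracket n x j, j) \<in> inversions n x" "(j, a) \<in> inversions n x"
      using le[of a] by (auto simp: iff)
    then have "(bracket n x j, a) \<in> inversions n x"
      unfolding iff' by auto
    then show ?thesis using iff by blast
  qed (use that in auto)
  ultimately show ?thesis unfolding bracket_vectors_def by auto
qed

lemma right_weak_le_iff_bracket_le:
  assumes x: "x \<in> Av312 n" and y: "y \<in> Av312 n"
  shows "right_weak_le n x y \<longleftrightarrow> bracket n x \<le> bracket n y"
proof
  assume *: "right_weak_le n x y"
  show "bracket n x \<le> bracket n y"
  proof (rule le_funI)
    fix a
    have "{b. (b, a) \<in> inversions n x} \<subseteq> {b. (b, a) \<in> inversions n y}"
      using * by (auto simp: right_weak_le_def)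
    moreover have "finite {b. (b, a) \<in> inversions n y}"
      by (rule finite_subset[of _ "{..bracket n y a}"]) (auto simp: inversions_Av312_iff[OF y])
    ultimately show "bracket n x a \<le> bracket n y a"
      by (simp add: bracket_def card_mono)
  qed
next
  assume *: "bracket n x \<le> bracket n y"
  show "right_weak_le n x y"
    unfolding right_weak_le_def
  proof (rule subrelI)
    fix b a assume "(b, a) \<in> inversions n x"
    then show "(b, a) \<in> inversions n y"
      unfolding inversions_Av312_iff[OF x] inversions_Av312_iff[OF y]
      using le_funD[OF *, of a] by simp
  qed
qed

text \<open>The permutation is built by prescribing from \<open>v\<close> which of two values stands
  first. Nestedness of the intervals makes this prescription transitive, hence a strict total order
  on \<open>{1..n}\<close>.\<close>

lemma bracket_surj:
  assumes v: "v \<in> bracket_vectors n"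
  shows "\<exists>x \<in> Av312 n. bracket n x = v"
proof -
  have vout: "v a = a" if "a \<notin> {1..n}" for a
    using v that by (auto simp: bracket_vectors_def)
  have vge: "a \<le> v a" for a
    using v vout[of a] by (cases "a \<in> {1..n}") (auto simp: bracket_vectors_def)
  have vle: "v a \<le> n" if "a \<in> {1..n}" for a
    using v that by (auto simp: bracket_vectors_def)
  have vj: "v j \<le> v a" if "a \<in> {1..n}" "a \<le> j" "j \<le> v a" for a j
    using v that by (auto simp: bracket_vectors_def)
  \<comment> \<open>Read \<open>R a b\<close> as: value \<open>a\<close> stands to the left of value
    \<open>b\<close>. A larger value is to the left of a smaller one iff it lies in the interval of
    the smaller one.\<close>
  define R where "R a b \<longleftrightarrow> (a < b \<and> v a < b) \<or> (b < a \<and> a \<le> v b)" for a b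
  have irr: "\<not> R a a" for a by (simp add: R_def)
  have tot: "R a b \<or> R b a" if "a \<noteq> b" for a b
    using that by (auto simp: R_def)
  have asym: "\<not> (R a b \<and> R b a)" for a b by (auto simp: R_def)
  have trans: "R a c" if R: "R a b" "R b c" and "a \<in> {1..n}" "b \<in> {1..n}" "c \<in> {1..n}" for a b c
  proof -
    consider "a < b" "v a < b" "b < c" "v b < c" | "a < b" "v a < b" "c < b" "b \<le> v c"
      | "b < a" "a \<le> v b" "b < c" "v b < c" | "b < a" "a \<le> v b" "c < b" "b \<le> v c"
      using R unfolding R_def by blast
    then show ?thesis
    proof cases
      case 2
      then have "a \<noteq> c" by auto
      then consider "a < c" | "c < a" by linarith
      then show ?thesis
      proof cases
        case 1
        moreover have "\<not> c \<le> v a" using 1 2 vj[of a c] that by auto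
        ultimately show ?thesis by (simp add: R_def)
      qed (use 2 in \<open>auto simp: R_def\<close>)
    next
      case 3
      then show ?thesis using vj[of b a] that by (auto simp: R_def)
    next
      case 4
      then show ?thesis using vj[of c b] that by (auto simp: R_def)
    qed (auto simp: R_def)
  qed
  \<comment> \<open>The position of a value is its rank with respect to \<open>R\<close>. The value
    itself is counted, so that ranks start at 1.\<close>
  define pos where "pos b = (if b \<in> {1..n} then card {c \<in> {1..n}. c = b \<or> R c b} else b)" for b
  have mono: "pos a < pos b" if "R a b" "a \<in> {1..n}" "b \<in> {1..n}" for a b
  proof -
    have "{c \<in> {1..n}. c = a \<or> R c a} \<subseteq> {c \<in> {1..n}. c = b \<or> R c b}"
      using that trans[of _ a b] by auto
    moreover have "b \<notin> {c \<in> {1..n}. c = a \<or> R c a}"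
      using that asym[of a b] irr[of a] by auto
    ultimately have "{c \<in> {1..n}. c = a \<or> R c a} \<subset> {c \<in> {1..n}. c = b \<or> R c b}"
      using that by blast
    then have "card {c \<in> {1..n}. c = a \<or> R c a} < card {c \<in> {1..n}. c = b \<or> R c b}"
      by (intro psubset_card_mono) simp_all
    then show ?thesis unfolding pos_def using that(2,3) by (simp only: if_True)
  qed
  have iff: "pos a < pos b \<longleftrightarrow> R a b" if "a \<in> {1..n}" "b \<in> {1..n}" for a b
    using mono[of a b] mono[of b a] tot[of a b] that by (cases "a = b") auto
  have inj: "inj_on pos {1..n}"
  proof (rule inj_onI, rule ccontr)
    fix a b assume "a \<in> {1..n}" "b \<in> {1..n}" "pos a = pos b" "a \<noteq> b"
    then show False using mono[of a b] mono[of b a] tot[of a b] by auto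
  qed
  have "pos ` {1..n} \<subseteq> {1..n}"
  proof
    fix m assume "m \<in> pos ` {1..n}"
    then obtain b where "b \<in> {1..n}" "m = pos b" by blast
    then have b: "b \<in> {1..n}" "m = card {c \<in> {1..n}. c = b \<or> R c b}"
      by (simp_all only: pos_def if_True)
    have "card {c \<in> {1..n}. c = b \<or> R c b} \<le> card {1..n}"
      by (rule card_mono) auto
    moreover have "card {c \<in> {1..n}. c = b \<or> R c b} > 0"
      using b(1) by (subst card_gt_0_iff) auto
    ultimately show "m \<in> {1..n}" using b(2) by simp
  qed
  with inj have "bij_betw pos {1..n} {1..n}"
    by (simp add: bij_betw_def endo_inj_surj)
  then have pp: "pos permutes {1..n}"
    by (rule bij_imp_permutes) (simp only: pos_def if_False)
  define x where "x = inv pos"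
  have x: "x permutes {1..n}" and ix: "inv x = pos"
    unfolding x_def using permutes_inv[OF pp] permutes_inv_inv[OF pp] by auto
  have inv_iff: "(b, a) \<in> inversions n x \<longleftrightarrow> a \<in> {1..n} \<and> a < b \<and> b \<le> v a" for a b
    unfolding inversions_permutes_iff[OF x] ix using iff[of b a] vle[of a]
    unfolding R_def by (metis atLeastAtMost_iff le_trans less_imp_le_nat not_less_iff_gr_or_eq)
  have "x \<in> Av312 n"
    unfolding Av312_def
  proof (intro CollectI conjI x notI)
    assume "\<exists>i1\<in>{1..n}. \<exists>i2\<in>{1..n}. \<exists>i3\<in>{1..n}. i1 < i2 \<and> i2 < i3 \<and> x i2 < x i3 \<and> x i3 < x i1"
    then obtain i1 i2 i3 where i: "i1 \<in> {1..n}" "i2 \<in> {1..n}" "i3 \<in> {1..n}"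
      "i1 < i2" "i2 < i3" "x i2 < x i3" "x i3 < x i1" by blast
    have ip: "pos (x i) = i" for i
      unfolding x_def using permutes_inverses(1)[OF pp] by auto
    have m: "x i1 \<in> {1..n}" "x i2 \<in> {1..n}" "x i3 \<in> {1..n}"
      using i permutes_in_image[OF x] by blast+
    \<comment> \<open>The two relations say \<open>x i1 \<le> v (x i2)\<close> and
      \<open>v (x i2) < x i3\<close>, which contradicts \<open>x i3 < x i1\<close>.\<close>
    have "R (x i1) (x i2)" "R (x i2) (x i3)"
      using iff[of "x i1" "x i2"] iff[of "x i2" "x i3"] m i by (auto simp: ip)
    with i show False by (auto simp: R_def)
  qed
  moreover have "bracket n x = v"
  proof
    fix a
    have "{b. (b, a) \<in> inversions n x} = (if a \<in> {1..n} then {a<..v a} else {})"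
      by (auto simp: inv_iff)
    then show "bracket n x a = v a" using vge[of a] vout[of a] by (auto simp: bracket_def)
  qed
  ultimately show ?thesis by blast
qed

lemma bij_betw_bracket: "bij_betw (bracket n) (Av312 n) (bracket_vectors n)"
proof (rule bij_betw_imageI)
  show "inj_on (bracket n) (Av312 n)"
  proof (rule inj_onI)
    fix x y assume *: "x \<in> Av312 n" "y \<in> Av312 n" "bracket n x = bracket n y"
    then have "right_weak_le n x y" "right_weak_le n y x"
      using right_weak_le_iff_bracket_le by simp_all
    then have "inversions n x = inversions n y" by (auto simp: right_weak_le_def)
    with * show "x = y" by (intro inversions_inject) (auto simp: Av312_def)
  qed
  show "bracket n ` Av312 n = bracket_vectors n"
    using bracket_mem bracket_surj by blast
qed

definition perm_of :: "nat \<Rightarrow> (nat \<Rightarrow> nat) \<Rightarrow> nat \<Rightarrow> nat" where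
  "perm_of n = the_inv_into (Av312 n) (bracket n)"

lemma bij_betw_perm_of: "bij_betw (perm_of n) (bracket_vectors n) (Av312 n)"
  unfolding perm_of_def by (rule bij_betw_the_inv_into[OF bij_betw_bracket])

lemma perm_of_mem: "v \<in> bracket_vectors n \<Longrightarrow> perm_of n v \<in> Av312 n"
  using bij_betw_perm_of bij_betwE by blast

lemma perm_of_eq_iff:
  "v \<in> bracket_vectors n \<Longrightarrow> w \<in> bracket_vectors n \<Longrightarrow> perm_of n v = perm_of n w \<longleftrightarrow> v = w"
  using bij_betw_perm_of[of n] by (metis bij_betw_imp_inj_on inj_onD)

lemma bracket_perm_of: "v \<in> bracket_vectors n \<Longrightarrow> bracket n (perm_of n v) = v"
  unfolding perm_of_def using f_the_inv_into_f_bij_betw[OF bij_betw_bracket] by blast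

lemma Av312_cases:
  assumes "x \<in> Av312 n"
  obtains v where "v \<in> bracket_vectors n" "x = perm_of n v"
  using assms bij_betw_perm_of[of n] by (metis bij_betw_imp_surj_on imageE)

lemma right_weak_le_perm_of_iff:
  "v \<in> bracket_vectors n \<Longrightarrow> w \<in> bracket_vectors n \<Longrightarrow>
     right_weak_le n (perm_of n v) (perm_of n w) \<longleftrightarrow> v \<le> w"
  by (simp add: right_weak_le_iff_bracket_le perm_of_mem bracket_perm_of)

lemma finite_Av312: "finite (Av312 n)"
  by (rule finite_subset[OF _ finite_permutations[of "{1..n}"]]) (auto simp: Av312_def)

section \<open>The Ungarian step on bracket vectors\<close>

lemma bracket_vectorsD:
  assumes "v \<in> bracket_vectors n"
  shows "a \<notin> {1..n} \<Longrightarrow> v a = a" "a \<le> v a" "a \<in> {1..n} \<Longrightarrow> v a \<le> n"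
    "a \<in> {1..n} \<Longrightarrow> a \<le> j \<Longrightarrow> j \<le> v a \<Longrightarrow> v j \<le> v a"
proof -
  show *: "a \<notin> {1..n} \<Longrightarrow> v a = a" "a \<in> {1..n} \<Longrightarrow> v a \<le> n"
    "a \<in> {1..n} \<Longrightarrow> a \<le> j \<Longrightarrow> j \<le> v a \<Longrightarrow> v j \<le> v a"
    using assms unfolding bracket_vectors_def by auto
  show "a \<le> v a"
    using assms *(1) unfolding bracket_vectors_def by (cases "a \<in> {1..n}") auto
qed

text \<open>The largest smaller end to which the interval of row \<open>a\<close> can be cut back
  without crossing an interval that starts inside it. The end \<open>a\<close> is always admissible
  and is also the value for an exhausted row. The range \<open>{a<..w}\<close> leaves out
  \<open>a\<close> because row \<open>a\<close> is the one being replaced.\<close>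

definition drop_last :: "(nat \<Rightarrow> nat) \<Rightarrow> nat \<Rightarrow> nat" where
  "drop_last v a = Max (insert a {w. a < w \<and> w < v a \<and> (\<forall>j\<in>{a<..w}. v j \<le> w)})"

definition drop_step :: "(nat \<Rightarrow> nat) \<Rightarrow> (nat \<Rightarrow> bool) \<Rightarrow> nat \<Rightarrow> nat" where
  "drop_step v s = (\<lambda>a. if s a then drop_last v a else v a)"

lemma drop_last_ge: "a \<le> drop_last v a"
  unfolding drop_last_def by (rule Max_ge) auto

lemma drop_last_mem: "drop_last v a \<in> insert a {w. a < w \<and> w < v a \<and> (\<forall>j\<in>{a<..w}. v j \<le> w)}"
  unfolding drop_last_def by (rule Max_in) auto

lemma drop_last_less: "a < v a \<Longrightarrow> drop_last v a < v a"
  using drop_last_mem[of v a] by auto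

lemma drop_last_fixed: "v a = a \<Longrightarrow> drop_last v a = a"
  using drop_last_mem[of v a] by auto

lemma drop_last_le: "a \<le> v a \<Longrightarrow> drop_last v a \<le> v a"
  using drop_last_less[of a v] drop_last_fixed[of v a] by (cases "v a = a") auto

lemma drop_last_closed: "a < j \<Longrightarrow> j \<le> drop_last v a \<Longrightarrow> v j \<le> drop_last v a"
  using drop_last_mem[of v a] by auto

lemma drop_last_greatest:
  assumes "a \<le> w" "w < v a" "\<And>j. a < j \<Longrightarrow> j \<le> w \<Longrightarrow> v j \<le> w"
  shows "w \<le> drop_last v a"
  unfolding drop_last_def using assms by (intro Max_ge) auto

lemma drop_step_le:
  assumes "v \<in> bracket_vectors n"
  shows "drop_step v s \<le> v"
  using bracket_vectorsD(2)[OF assms] by (auto simp: le_fun_def drop_step_def intro!: drop_last_le)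

text \<open>All new ends are computed from the old vector. Every interval starting inside the new
  interval of \<open>a\<close> but after \<open>a\<close> already ended inside it before the step,
  and the step only shortens intervals.\<close>

lemma drop_step_mem:
  assumes v: "v \<in> bracket_vectors n"
  shows "drop_step v s \<in> bracket_vectors n"
  unfolding bracket_vectors_def
proof (intro CollectI conjI allI impI ballI)
  fix a assume "a \<notin> {1..n}"
  then show "drop_step v s a = a"
    using bracket_vectorsD(1)[OF v] drop_last_fixed by (auto simp: drop_step_def)
next
  fix a assume a: "a \<in> {1..n}"
  show "a \<le> drop_step v s a"
    using drop_last_ge bracket_vectorsD(2)[OF v] by (auto simp: drop_step_def)
  show "drop_step v s a \<le> n"
    using le_funD[OF drop_step_le[OF v], of s a] bracket_vectorsD(3)[OF v a] by linarith
  fix j assume j: "j \<in> {a..drop_step v s a}"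
  show "drop_step v s j \<le> drop_step v s a"
  proof (cases "j = a")
    case False
    have "v j \<le> drop_step v s a"
      using j False drop_last_closed[of a j v] bracket_vectorsD(4)[OF v a, of j]
      by (auto simp: drop_step_def split: if_splits)
    then show ?thesis
      using le_funD[OF drop_step_le[OF v], of s j] by linarith
  qed auto
qed

lemma drop_last_update_mem:
  assumes "v \<in> bracket_vectors n"
  shows "v(a := drop_last v a) \<in> bracket_vectors n"
proof -
  have "v(a := drop_last v a) = drop_step v (\<lambda>c. c = a)"
    by (auto simp: drop_step_def)
  then show ?thesis using drop_step_mem[OF assms] by simp
qed

section \<open>Covers, meets and extreme elements of the Tamari lattice in row coordinates\<close>

lemma Tam_simps [simp]:
  "carrier (Tam n) = Av312 n" "eq (Tam n) = (=)" "le (Tam n) = right_weak_le n"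
  by (simp_all add: Tam_def)

lemma lless_Tam_iff: "lless (Tam n) x y \<longleftrightarrow> right_weak_le n x y \<and> x \<noteq> y"
  by (simp add: lless_def)

lemma lless_Tam_perm_of_iff:
  assumes "v \<in> bracket_vectors n" "w \<in> bracket_vectors n"
  shows "lless (Tam n) (perm_of n v) (perm_of n w) \<longleftrightarrow> v < w"
  by (metis assms lless_Tam_iff order_less_le perm_of_eq_iff right_weak_le_perm_of_iff)

definition active :: "(nat \<Rightarrow> nat) \<Rightarrow> nat set" where
  "active v = {a. a < v a}"

lemma active_subset: "v \<in> bracket_vectors n \<Longrightarrow> active v \<subseteq> {1..n}"
  using bracket_vectorsD(1) unfolding active_def by fastforce

lemma drop_last_update_less:
  assumes "a \<in> active v"
  shows "v(a := drop_last v a) < v"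
  using drop_last_less[of a v] assms
  by (auto simp: less_fun_def le_fun_def active_def not_le intro!: exI[of _ a])

text \<open>A vector strictly in between can differ from \<open>v\<close> in row \<open>a\<close>
  only. Its entry there is then an admissible end for cutting back row \<open>a\<close>, so it
  cannot exceed \<open>drop_last v a\<close>.\<close>

lemma drop_last_update_covered:
  assumes v: "v \<in> bracket_vectors n" and u: "u \<in> bracket_vectors n"
    and less: "v(a := drop_last v a) < u" "u < v"
  shows False
proof -
  have le: "v(a := drop_last v a) \<le> u" "u \<le> v"
    using less by auto
  have eq: "u j = v j" if "j \<noteq> a" for j
    using le_funD[OF le(1), of j] le_funD[OF le(2), of j] that by auto
  have "u a \<noteq> v a"
    using eq less(2) by (metis ext less_irrefl)
  then have "u a < v a"
    using le_funD[OF le(2), of a] by simp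
  have "a \<in> {1..n}"
    using \<open>u a \<noteq> v a\<close> bracket_vectorsD(1)[OF v] bracket_vectorsD(1)[OF u] by metis
  have "u a \<le> drop_last v a"
  proof (rule drop_last_greatest)
    show "a \<le> u a" by (rule bracket_vectorsD(2)[OF u])
    show "u a < v a" by fact
    fix j assume "a < j" "j \<le> u a"
    then show "v j \<le> u a"
      using bracket_vectorsD(4)[OF u \<open>a \<in> {1..n}\<close>, of j] eq[of j] by auto
  qed
  then have "u = v(a := drop_last v a)"
    using eq le_funD[OF le(1), of a] by (intro ext) auto
  with less(1) show False by simp
qed

text \<open>Take the largest row \<open>a\<close> in which \<open>w\<close> is smaller. Above
  \<open>a\<close> the two vectors agree, so nestedness for \<open>w\<close> shows that
  \<open>w a\<close> is an admissible end for cutting back row \<open>a\<close> of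
  \<open>v\<close>.\<close>

lemma less_bracket_vector_below_cover:
  assumes v: "v \<in> bracket_vectors n" and w: "w \<in> bracket_vectors n" and less: "w < v"
  shows "\<exists>a \<in> active v. w \<le> v(a := drop_last v a)"
proof -
  define D where "D = {a. w a < v a}"
  have "D \<subseteq> {1..n}"
  proof
    fix a assume "a \<in> D"
    then have "w a \<noteq> v a" by (simp add: D_def)
    then show "a \<in> {1..n}"
      using bracket_vectorsD(1)[OF v] bracket_vectorsD(1)[OF w] by metis
  qed
  then have fin: "finite D" using finite_subset by blast
  have "D \<noteq> {}"
    using less by (auto simp: D_def less_fun_def le_fun_def not_le)
  define a where "a = Max D"
  have "a \<in> D" unfolding a_def using fin \<open>D \<noteq> {}\<close> by simp
  have le: "w j \<le> v j" for j using less by (auto simp: less_fun_def le_fun_def)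
  have eq: "w j = v j" if "a < j" for j
  proof (rule ccontr)
    assume "w j \<noteq> v j"
    then have "j \<in> D" using le[of j] by (simp add: D_def)
    then show False using Max_ge[OF fin] that a_def by (metis not_le)
  qed
  have "w a < v a" using \<open>a \<in> D\<close> by (simp add: D_def)
  have "w a \<le> drop_last v a"
  proof (rule drop_last_greatest)
    show "a \<le> w a" by (rule bracket_vectorsD(2)[OF w])
    show "w a < v a" by fact
    fix j assume "a < j" "j \<le> w a"
    then show "v j \<le> w a"
      using bracket_vectorsD(4)[OF w, of a j] eq[of j] \<open>a \<in> D\<close> \<open>D \<subseteq> {1..n}\<close> by auto
  qed
  then have "w \<le> v(a := drop_last v a)" using le by (auto simp: le_fun_def)
  moreover have "a \<in> active v"
    using \<open>w a < v a\<close> bracket_vectorsD(2)[OF w, of a] by (simp add: active_def)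
  ultimately show ?thesis by blast
qed

lemma lower_covers_Tam:
  assumes v: "v \<in> bracket_vectors n"
  shows "lower_covers (Tam n) (perm_of n v) = (\<lambda>a. perm_of n (v(a := drop_last v a))) ` active v"
proof
  show "(\<lambda>a. perm_of n (v(a := drop_last v a))) ` active v \<subseteq> lower_covers (Tam n) (perm_of n v)"
  proof
    fix y assume "y \<in> (\<lambda>a. perm_of n (v(a := drop_last v a))) ` active v"
    then obtain a where a: "a \<in> active v" and y: "y = perm_of n (v(a := drop_last v a))" by blast
    note m = drop_last_update_mem[OF v, of a]
    have "\<not> (\<exists>z\<in>carrier (Tam n). lless (Tam n) y z \<and> lless (Tam n) z (perm_of n v))"
    proof
      assume "\<exists>z\<in>carrier (Tam n). lless (Tam n) y z \<and> lless (Tam n) z (perm_of n v)"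
      then obtain z where z: "z \<in> Av312 n" "lless (Tam n) y z" "lless (Tam n) z (perm_of n v)"
        by auto
      from Av312_cases[OF z(1)] obtain u where "u \<in> bracket_vectors n" "z = perm_of n u" .
      then show False
        using z drop_last_update_covered[OF v] lless_Tam_perm_of_iff v m y by metis
    qed
    then show "y \<in> lower_covers (Tam n) (perm_of n v)"
      using perm_of_mem[OF m] lless_Tam_perm_of_iff[OF m v] drop_last_update_less[OF a] y
      unfolding lower_covers_def by simp
  qed
  show "lower_covers (Tam n) (perm_of n v) \<subseteq> (\<lambda>a. perm_of n (v(a := drop_last v a))) ` active v"
  proof
    fix y assume "y \<in> lower_covers (Tam n) (perm_of n v)"
    then have y: "y \<in> Av312 n" "lless (Tam n) y (perm_of n v)"
      "\<And>z. z \<in> Av312 n \<Longrightarrow> lless (Tam n) y z \<Longrightarrow> lless (Tam n) z (perm_of n v) \<Longrightarrow> False"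
      unfolding lower_covers_def by auto
    from Av312_cases[OF y(1)] obtain w where w: "w \<in> bracket_vectors n" "y = perm_of n w" .
    have "w < v" using y(2) lless_Tam_perm_of_iff w v by metis
    from less_bracket_vector_below_cover[OF v w(1) this] obtain a
      where a: "a \<in> active v" "w \<le> v(a := drop_last v a)" by blast
    note m = drop_last_update_mem[OF v, of a]
    have "w = v(a := drop_last v a)"
      using y(3)[OF perm_of_mem[OF m]] lless_Tam_perm_of_iff w v m a drop_last_update_less[OF a(1)]
      by (metis order_le_less)
    with a w show "y \<in> (\<lambda>a. perm_of n (v(a := drop_last v a))) ` active v" by auto
  qed
qed

lemma right_weak_le_antisym:
  assumes "x \<in> Av312 n" "y \<in> Av312 n" "right_weak_le n x y" "right_weak_le n y x"
  shows "x = y"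
proof (rule inversions_inject)
  show "x permutes {1..n}" "y permutes {1..n}" using assms by (simp_all add: Av312_def)
  show "inversions n x = inversions n y" using assms(3,4) unfolding right_weak_le_def by blast
qed

text \<open>Meets are defined by choice among the greatest lower bounds; antisymmetry leaves only
  one candidate.\<close>

lemma inf_Tam_eqI:
  assumes "greatest (Tam n) g (Lower (Tam n) A)"
  shows "\<Sqinter>\<^bsub>Tam n\<^esub>A = g"
  unfolding inf_def
proof (rule some_equality)
  fix h assume "greatest (Tam n) h (Lower (Tam n) A)"
  with assms show "h = g"
    unfolding greatest_def by (intro right_weak_le_antisym[of _ n]) auto
qed fact

text \<open>The order is pointwise and each cover lowers a single row, so a common lower bound of
  the chosen covers is a vector below all the individual reductions at once. The pointwise minimum
  is again a bracket vector by \<open>drop_step_mem\<close>, hence it is the meet.\<close>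

lemma inf_Tam_lower_covers:
  assumes v: "v \<in> bracket_vectors n"
  shows "\<Sqinter>\<^bsub>Tam n\<^esub>({perm_of n v} \<union> {y \<in> lower_covers (Tam n) (perm_of n v). \<tau> y}) =
    perm_of n (drop_step v (\<lambda>a. a \<in> active v \<and> \<tau> (perm_of n (v(a := drop_last v a)))))"
    (is "_ = perm_of n (drop_step v ?s)")
proof (rule inf_Tam_eqI)
  let ?g = "drop_step v ?s"
  let ?A = "{perm_of n v} \<union> {y \<in> lower_covers (Tam n) (perm_of n v). \<tau> y}"
  have A: "?A = insert (perm_of n v)
      ((\<lambda>a. perm_of n (v(a := drop_last v a))) ` {a \<in> active v. \<tau> (perm_of n (v(a := drop_last v a)))})"
    unfolding lower_covers_Tam[OF v] by auto
  have g: "?g \<in> bracket_vectors n" by (rule drop_step_mem[OF v])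
  have low: "perm_of n u \<in> Lower (Tam n) ?A \<longleftrightarrow> u \<le> ?g" if u: "u \<in> bracket_vectors n" for u
  proof -
    have "?A \<subseteq> Av312 n"
      unfolding A using perm_of_mem[OF v] perm_of_mem[OF drop_last_update_mem[OF v]] by blast
    then have "perm_of n u \<in> Lower (Tam n) ?A \<longleftrightarrow> (\<forall>x\<in>?A. right_weak_le n (perm_of n u) x)"
      using perm_of_mem[OF u] unfolding Lower_def Tam_simps by blast
    also have "\<dots> \<longleftrightarrow> right_weak_le n (perm_of n u) (perm_of n v) \<and>
        (\<forall>a. ?s a \<longrightarrow> right_weak_le n (perm_of n u) (perm_of n (v(a := drop_last v a))))"
      unfolding A by blast
    also have "\<dots> \<longleftrightarrow> u \<le> v \<and> (\<forall>a. ?s a \<longrightarrow> u \<le> v(a := drop_last v a))"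
      unfolding right_weak_le_perm_of_iff[OF u v]
        right_weak_le_perm_of_iff[OF u drop_last_update_mem[OF v]] ..
    also have "\<dots> \<longleftrightarrow> u \<le> ?g"
    proof
      assume *: "u \<le> v \<and> (\<forall>a. ?s a \<longrightarrow> u \<le> v(a := drop_last v a))"
      show "u \<le> ?g"
      proof (rule le_funI)
        fix a show "u a \<le> ?g a"
        proof (cases "?s a")
          case True
          then have "u \<le> v(a := drop_last v a)" using * by blast
          moreover have "?g a = drop_last v a" using True unfolding drop_step_def by (rule if_P)
          ultimately show ?thesis using le_funD[of u "v(a := drop_last v a)" a] by simp
        next
          case False
          then have "?g a = v a" unfolding drop_step_def by (rule if_not_P)
          then show ?thesis using * by (simp add: le_fun_def)
        qed
      qed
    next
      assume *: "u \<le> ?g"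
      then have "u \<le> v" using drop_step_le[OF v, of ?s] by (rule order_trans)
      moreover have "u \<le> v(a := drop_last v a)" if "?s a" for a
      proof (rule le_funI)
        fix j
        have "?g a = drop_last v a" using that unfolding drop_step_def by (rule if_P)
        then show "u j \<le> (v(a := drop_last v a)) j"
          using le_funD[OF \<open>u \<le> v\<close>, of j] le_funD[OF *, of a] by (cases "j = a") simp_all
      qed
      ultimately show "u \<le> v \<and> (\<forall>a. ?s a \<longrightarrow> u \<le> v(a := drop_last v a))" by blast
    qed
    finally show ?thesis .
  qed
  show "greatest (Tam n) (perm_of n ?g) (Lower (Tam n) ?A)"
    unfolding greatest_def
  proof (intro conjI ballI)
    show "Lower (Tam n) ?A \<subseteq> carrier (Tam n)" by (simp add: Lower_def)
    show "perm_of n ?g \<in> Lower (Tam n) ?A" using low[OF g] by simp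
    fix x assume x: "x \<in> Lower (Tam n) ?A"
    then have "x \<in> Av312 n" by (simp add: Lower_def)
    from Av312_cases[OF this] obtain u where u: "u \<in> bracket_vectors n" "x = perm_of n u" .
    with x low[OF u(1)] have "u \<le> ?g" by blast
    with u g show "le (Tam n) x (perm_of n ?g)"
      using right_weak_le_perm_of_iff by simp
  qed
qed

definition top_vector :: "nat \<Rightarrow> nat \<Rightarrow> nat" where
  "top_vector n = (\<lambda>a. if a \<in> {1..n} then n else a)"

lemma top_vector_mem: "top_vector n \<in> bracket_vectors n"
  by (auto simp: bracket_vectors_def top_vector_def)

lemma id_mem_bracket_vectors: "(\<lambda>a. a) \<in> bracket_vectors n"
  by (auto simp: bracket_vectors_def)

lemma top_Tam: "\<top>\<^bsub>Tam n\<^esub> = perm_of n (top_vector n)"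
  unfolding top_def
proof (rule some_equality)
  show *: "greatest (Tam n) (perm_of n (top_vector n)) (carrier (Tam n))"
    unfolding greatest_def
  proof (intro conjI ballI)
    fix x assume "x \<in> carrier (Tam n)"
    then have "x \<in> Av312 n" by simp
    from Av312_cases[OF this] obtain u where u: "u \<in> bracket_vectors n" "x = perm_of n u" .
    moreover have "u \<le> top_vector n"
      using bracket_vectorsD(1,3)[OF u(1)] by (auto simp: le_fun_def top_vector_def)
    ultimately show "le (Tam n) x (perm_of n (top_vector n))"
      using right_weak_le_perm_of_iff[OF u(1) top_vector_mem] by simp
  qed (use perm_of_mem[OF top_vector_mem] in auto)
  fix h assume "greatest (Tam n) h (carrier (Tam n))"
  with * show "h = perm_of n (top_vector n)"
    unfolding greatest_def by (intro right_weak_le_antisym[of _ n]) auto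
qed

lemma bottom_Tam: "\<bottom>\<^bsub>Tam n\<^esub> = perm_of n (\<lambda>a. a)"
  unfolding bottom_def
proof (rule some_equality)
  show *: "least (Tam n) (perm_of n (\<lambda>a. a)) (carrier (Tam n))"
    unfolding least_def
  proof (intro conjI ballI)
    fix x assume "x \<in> carrier (Tam n)"
    then have "x \<in> Av312 n" by simp
    from Av312_cases[OF this] obtain u where u: "u \<in> bracket_vectors n" "x = perm_of n u" .
    moreover have "(\<lambda>a. a) \<le> u"
      using bracket_vectorsD(2)[OF u(1)] by (auto simp: le_fun_def)
    ultimately show "le (Tam n) (perm_of n (\<lambda>a. a)) x"
      using right_weak_le_perm_of_iff[OF id_mem_bracket_vectors u(1)] by simp
  qed (use perm_of_mem[OF id_mem_bracket_vectors] in auto)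
  fix h assume "least (Tam n) h (carrier (Tam n))"
  with * show "h = perm_of n (\<lambda>a. a)"
    unfolding least_def by (intro right_weak_le_antisym[of _ n]) auto
qed

section \<open>Pathwise descent of a single row\<close>

fun row_chain :: "nat \<Rightarrow> (nat \<times> nat \<Rightarrow> bool) \<Rightarrow> nat \<Rightarrow> (nat \<Rightarrow> nat)" where
  "row_chain n \<xi> 0 = top_vector n"
| "row_chain n \<xi> (Suc k) = drop_step (row_chain n \<xi> k) (\<lambda>a. \<xi> (k, a))"

lemma row_chain_mem: "row_chain n \<xi> k \<in> bracket_vectors n"
  by (induction k) (auto simp: top_vector_mem drop_step_mem)

lemma row_chain_no_success:
  assumes "c \<in> {1..n}" "\<And>j. j < k \<Longrightarrow> \<not> \<xi> (j, c)"
  shows "row_chain n \<xi> k c = n"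
  using assms by (induction k) (auto simp: top_vector_def drop_step_def)

text \<open>The first success of \<open>c\<close> brings it below \<open>A\<close>, and every later
  one lowers it by at least 1 until it reaches \<open>c\<close>. Simultaneous first successes are
  allowed, because a step reads the old vector. The value \<open>A = Suc n\<close> stands for an
  artificial row beyond the last one, which imposes no condition.\<close>

lemma row_chain_after_success:
  assumes c: "c \<in> {1..n}" "c < A" "A \<le> Suc n"
    and first: "\<And>j. j < K \<Longrightarrow> A \<le> n \<Longrightarrow> \<xi> (j, A) \<Longrightarrow> \<exists>i\<le>j. \<xi> (i, c)"
  shows "k \<le> K \<Longrightarrow> card {j. j < k \<and> \<xi> (j, c)} \<noteq> 0 \<Longrightarrow>
    row_chain n \<xi> k c \<le> max c (A - card {j. j < k \<and> \<xi> (j, c)})"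
proof (induction k)
  case (Suc k)
  let ?v = "row_chain n \<xi> k"
  let ?m = "card {j. j < k \<and> \<xi> (j, c)}"
  show ?case
  proof (cases "\<xi> (k, c)")
    case False
    then have "{j. j < Suc k \<and> \<xi> (j, c)} = {j. j < k \<and> \<xi> (j, c)}"
      by (auto simp: less_Suc_eq)
    then show ?thesis using Suc False by (simp add: drop_step_def)
  next
    case True
    then have "{j. j < Suc k \<and> \<xi> (j, c)} = insert k {j. j < k \<and> \<xi> (j, c)}"
      by (auto simp: less_Suc_eq)
    then have m: "card {j. j < Suc k \<and> \<xi> (j, c)} = Suc ?m" by simp
    have next_eq: "row_chain n \<xi> (Suc k) c = drop_last ?v c"
      using True by (simp add: drop_step_def)
    have "drop_last ?v c \<le> max c (A - Suc ?m)"
    proof (cases "?m = 0")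
      case zero: True
      then have none: "\<not> \<xi> (j, c)" if "j < k" for j
        using that by auto
      \<comment> \<open>At the first success of \<open>c\<close>, row \<open>A\<close> still has end
        \<open>n\<close>. An end of \<open>c\<close> in the range from \<open>A\<close> to
        \<open>n - 1\<close> would cross that interval, so the end has to fall below
        \<open>A\<close>.\<close>
      have "drop_last ?v c \<le> A - 1"
      proof (cases "A \<le> n")
        case True
        have "\<not> \<xi> (j, A)" if "j < k" for j
          using first[of j] none that Suc.prems(1) True
          by (meson Suc_leD le_less_trans less_le_trans)
        then have vc: "?v c = n" and vA: "?v A = n"
          using row_chain_no_success[of c n k \<xi>] row_chain_no_success[of A n k \<xi>]
            none True c by auto
        have "drop_last ?v c < n" using drop_last_less[of c ?v] vc True c by simp
        moreover have "\<not> A \<le> drop_last ?v c"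
          using drop_last_closed[of c A ?v] vA c \<open>drop_last ?v c < n\<close> by auto
        ultimately show ?thesis by linarith
      next
        case False
        then show ?thesis
          using c drop_last_le[of c ?v] bracket_vectorsD(2)[OF row_chain_mem, of c n \<xi> k]
            bracket_vectorsD(3)[OF row_chain_mem c(1), of \<xi> k] by linarith
      qed
      then show ?thesis unfolding zero by linarith
    next
      case False
      then have IH: "?v c \<le> max c (A - ?m)"
        using Suc by simp
      show ?thesis
      proof (cases "?v c = c")
        case True
        then show ?thesis by (simp add: drop_last_fixed)
      next
        case False
        then have "c < ?v c" using bracket_vectorsD(2)[OF row_chain_mem, of c n \<xi> k] by simp
        then show ?thesis using drop_last_less[of c ?v] IH by auto
      qed
    qed
    then show ?thesis unfolding next_eq m .
  qed
qed simp

lemma row_chain_finished: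
  assumes "c \<in> {1..n}" "c < A" "A \<le> Suc n"
    and "\<And>j. j < K \<Longrightarrow> A \<le> n \<Longrightarrow> \<xi> (j, A) \<Longrightarrow> \<exists>i\<le>j. \<xi> (i, c)"
    and "A - c \<le> card {j. j < K \<and> \<xi> (j, c)}"
  shows "row_chain n \<xi> K c = c"
proof -
  have "row_chain n \<xi> K c \<le> max c (A - card {j. j < K \<and> \<xi> (j, c)})"
    using assms(2,5) by (intro row_chain_after_success[of c n A K] assms) linarith+
  then show ?thesis
    using assms(5) bracket_vectorsD(2)[OF row_chain_mem, of c n \<xi> K] by linarith
qed

section \<open>Reduction to independent row coins\<close>

abbreviation coin_field :: "real \<Rightarrow> 'i set \<Rightarrow> ('i \<Rightarrow> bool) pmf" where
  "coin_field p I \<equiv> Pi_pmf I False (\<lambda>_. bernoulli_pmf p)"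

text \<open>The Markov property: the state after \<open>k\<close> steps reads only coins of times
  below \<open>k\<close>, and the coins of time \<open>k\<close> are independent of those. It is
  stated abstractly so as to apply both to the chain on permutations and to the chain on
  rows.\<close>

lemma map_pmf_driven_chain_Suc:
  fixes F :: "(nat \<times> 'i \<Rightarrow> bool) \<Rightarrow> nat \<Rightarrow> 's" and step :: "'s \<Rightarrow> ('i \<Rightarrow> bool) \<Rightarrow> 's"
  assumes I: "finite I"
    and F0: "\<And>\<omega>. F \<omega> 0 = s0"
    and FSuc: "\<And>\<omega> k. F \<omega> (Suc k) = step (F \<omega> k) (\<lambda>i. \<omega> (k, i))"
  shows "map_pmf (\<lambda>\<omega>. F \<omega> (Suc k)) (coin_field p ({..<Suc k} \<times> I)) =
    bind_pmf (map_pmf (\<lambda>\<omega>. F \<omega> k) (coin_field p ({..<k} \<times> I)))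
      (\<lambda>x. map_pmf (step x) (coin_field p I))"
proof -
  have cong: "F \<omega> j = F \<omega>' j" if "\<And>l i. l < j \<Longrightarrow> \<omega> (l, i) = \<omega>' (l, i)" for \<omega> \<omega>' j
    using that
  proof (induction j)
    case (Suc j)
    have "F \<omega> j = F \<omega>' j"
      by (rule Suc.IH) (rule Suc.prems, simp)
    moreover have "(\<lambda>i. \<omega> (j, i)) = (\<lambda>i. \<omega>' (j, i))"
      using Suc.prems by auto
    ultimately show ?case by (simp add: FSuc)
  qed (simp add: F0)
  let ?P = "coin_field p ({..<k} \<times> I)" and ?Q = "coin_field p ({k} \<times> I)"
  have split: "{..<Suc k} \<times> I = {..<k} \<times> I \<union> {k} \<times> I" by auto
  have merge: "F (\<lambda>x. if x \<in> {..<k} \<times> I then f x else g x) (Suc k) = step (F f k) (g \<circ> Pair k)"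
    if f: "f \<in> set_pmf ?P" and g: "g \<in> set_pmf ?Q" for f g
  proof -
    have f0: "f x = False" if "x \<notin> {..<k} \<times> I" for x
      using f that set_Pi_pmf_subset[of "{..<k} \<times> I" False] I by blast
    have g0: "g x = False" if "x \<notin> {k} \<times> I" for x
      using g that set_Pi_pmf_subset[of "{k} \<times> I" False] I by blast
    have "F (\<lambda>x. if x \<in> {..<k} \<times> I then f x else g x) k = F f k"
      by (rule cong) (use f0 g0 in auto)
    then show ?thesis by (simp add: FSuc o_def)
  qed
  have slice: "coin_field p I = map_pmf (\<lambda>g. g \<circ> Pair k) ?Q"
    by (rule Pi_pmf_bij_betw[OF I]) (auto simp: bij_betw_def inj_on_def)
  have "map_pmf (\<lambda>\<omega>. F \<omega> (Suc k)) (coin_field p ({..<Suc k} \<times> I)) =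
    map_pmf (\<lambda>(f, g). F (\<lambda>x. if x \<in> {..<k} \<times> I then f x else g x) (Suc k)) (pair_pmf ?P ?Q)"
    unfolding split by (subst Pi_pmf_union) (use I in \<open>auto simp: map_pmf_comp case_prod_unfold\<close>)
  also have "\<dots> = map_pmf (\<lambda>(f, g). step (F f k) (g \<circ> Pair k)) (pair_pmf ?P ?Q)"
  proof (rule map_pmf_cong[OF refl])
    fix x assume "x \<in> set_pmf (pair_pmf ?P ?Q)"
    then have "fst x \<in> set_pmf ?P" "snd x \<in> set_pmf ?Q" by auto
    from merge[OF this] show "(case x of (f, g) \<Rightarrow> F (\<lambda>x. if x \<in> {..<k} \<times> I then f x else g x) (Suc k)) =
        (case x of (f, g) \<Rightarrow> step (F f k) (g \<circ> Pair k))"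
      by (simp only: case_prod_unfold)
  qed
  also have "\<dots> = bind_pmf ?P (\<lambda>f. map_pmf (\<lambda>g. step (F f k) (g \<circ> Pair k)) ?Q)"
    by (simp add: pair_pmf_def map_bind_pmf map_pmf_def bind_assoc_pmf bind_return_pmf)
  also have "\<dots> = bind_pmf (map_pmf (\<lambda>\<omega>. F \<omega> k) ?P) (\<lambda>x. map_pmf (step x) (coin_field p I))"
    unfolding slice by (simp add: bind_map_pmf map_pmf_comp)
  finally show ?thesis .
qed

text \<open>The left side reads only the coins of the lower covers, which correspond bijectively to
  the active rows. Both coin fields therefore restrict to the same field on \<open>active v\<close>;
  the coin of an exhausted row has no effect on \<open>drop_step\<close>.\<close>

lemma map_pmf_Tam_step:
  assumes v: "v \<in> bracket_vectors n"
  shows "map_pmf (\<lambda>\<tau>. \<Sqinter>\<^bsub>Tam n\<^esub>({perm_of n v} \<union> {y \<in> lower_covers (Tam n) (perm_of n v). \<tau> y}))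
      (coin_field p (Av312 n)) =
    map_pmf (\<lambda>s. perm_of n (drop_step v s)) (coin_field p {1..n})"
proof -
  define h where "h a = perm_of n (v(a := drop_last v a))" for a
  have act: "active v \<subseteq> {1..n}" "finite (active v)"
    using active_subset[OF v] finite_subset by auto
  have inj: "inj_on h (active v)"
  proof (rule inj_onI, rule ccontr)
    fix a b assume *: "a \<in> active v" "b \<in> active v" "h a = h b" "a \<noteq> b"
    then have "v(a := drop_last v a) = v(b := drop_last v b)"
      using perm_of_eq_iff[OF drop_last_update_mem[OF v] drop_last_update_mem[OF v]]
      by (simp add: h_def)
    from fun_cong[OF this, of a] show False
      using * drop_last_less[of a v] by (simp add: active_def)
  qed
  \<comment> \<open>For an inactive row, \<open>h a\<close> is \<open>perm_of n v\<close> itself and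
    not a cover. Hence reindexing by \<open>h\<close> gives the default value \<open>False\<close>
    outside \<open>active v\<close>.\<close>
  have inact: "h a \<notin> h ` active v" if "a \<notin> active v" for a
  proof
    have "v a = a" using that bracket_vectorsD(2)[OF v, of a] by (simp add: active_def)
    then have "v(a := drop_last v a) = v" using drop_last_fixed[of v a] by auto
    moreover assume "h a \<in> h ` active v"
    then obtain b where b: "b \<in> active v" "h a = h b" by blast
    ultimately have "v = v(b := drop_last v b)"
      using perm_of_eq_iff[OF drop_last_update_mem[OF v] drop_last_update_mem[OF v], of a b]
      by (simp add: h_def)
    with drop_last_update_less[OF b(1)] show False by simp
  qed
  have A: "coin_field p (active v) = map_pmf (\<lambda>s a. a \<in> active v \<and> s a) (coin_field p {1..n})"
    by (subst Pi_pmf_subset[OF _ act(1)]) (auto intro!: map_pmf_cong)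
  have sub: "h ` active v \<subseteq> Av312 n"
    using perm_of_mem[OF drop_last_update_mem[OF v]] by (auto simp: h_def)
  have "coin_field p (active v) = map_pmf (\<lambda>g. g \<circ> h) (coin_field p (h ` active v))"
    by (rule Pi_pmf_bij_betw[OF act(2)]) (use inj inact in \<open>auto simp: bij_betw_def\<close>)
  also have "coin_field p (h ` active v) =
      map_pmf (\<lambda>f x. if x \<in> h ` active v then f x else False) (coin_field p (Av312 n))"
    by (rule Pi_pmf_subset[OF finite_Av312 sub])
  also have "map_pmf (\<lambda>g. g \<circ> h) \<dots> = map_pmf (\<lambda>\<tau> a. a \<in> active v \<and> \<tau> (h a)) (coin_field p (Av312 n))"
    unfolding map_pmf_comp using inact by (intro map_pmf_cong) (auto simp: fun_eq_iff)
  finally have B: "coin_field p (active v) =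
      map_pmf (\<lambda>\<tau> a. a \<in> active v \<and> \<tau> (h a)) (coin_field p (Av312 n))" .
  have "map_pmf (\<lambda>\<tau>. \<Sqinter>\<^bsub>Tam n\<^esub>({perm_of n v} \<union> {y \<in> lower_covers (Tam n) (perm_of n v). \<tau> y}))
      (coin_field p (Av312 n)) =
    map_pmf (\<lambda>s. perm_of n (drop_step v s)) (coin_field p (active v))"
    unfolding B map_pmf_comp inf_Tam_lower_covers[OF v] h_def ..
  also have "\<dots> = map_pmf (\<lambda>s. perm_of n (drop_step v s)) (coin_field p {1..n})"
  proof -
    have "drop_step v (\<lambda>a. a \<in> active v \<and> s a) = drop_step v s" for s
    proof
      fix a show "drop_step v (\<lambda>a. a \<in> active v \<and> s a) a = drop_step v s a"
        using bracket_vectorsD(2)[OF v, of a] drop_last_fixed[of v a]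
        by (cases "a \<in> active v") (auto simp: drop_step_def active_def)
    qed
    then show ?thesis unfolding A map_pmf_comp by simp
  qed
  finally show ?thesis .
qed

text \<open>The step kernels agree at every bracket vector, so the laws agree by induction on the
  time. Only laws at a single time are compared; a sum of tail probabilities depends on nothing
  more.\<close>

lemma map_pmf_ungarian_chain_Tam:
  "map_pmf (\<lambda>\<omega>. ungarian_chain (Tam n) \<omega> k) (coin_field p ({..<k} \<times> Av312 n)) =
   map_pmf (\<lambda>\<xi>. perm_of n (row_chain n \<xi> k)) (coin_field p ({..<k} \<times> {1..n}))"
proof (induction k)
  case 0
  then show ?case by (simp add: top_Tam)
next
  case (Suc k)
  let ?step = "\<lambda>x \<tau>. \<Sqinter>\<^bsub>Tam n\<^esub>({x} \<union> {y \<in> lower_covers (Tam n) x. \<tau> y})"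
  let ?R = "coin_field p ({..<k} \<times> {1..n})"
  have "map_pmf (\<lambda>\<omega>. ungarian_chain (Tam n) \<omega> (Suc k)) (coin_field p ({..<Suc k} \<times> Av312 n)) =
    bind_pmf (map_pmf (\<lambda>\<omega>. ungarian_chain (Tam n) \<omega> k) (coin_field p ({..<k} \<times> Av312 n)))
      (\<lambda>x. map_pmf (?step x) (coin_field p (Av312 n)))"
    by (rule map_pmf_driven_chain_Suc[OF finite_Av312]) (simp_all add: Let_def)
  also have "\<dots> = bind_pmf ?R (\<lambda>\<xi>. map_pmf (?step (perm_of n (row_chain n \<xi> k))) (coin_field p (Av312 n)))"
    unfolding Suc.IH by (simp add: bind_map_pmf)
  also have "\<dots> = bind_pmf ?R (\<lambda>\<xi>. map_pmf (\<lambda>s. perm_of n (drop_step (row_chain n \<xi> k) s)) (coin_field p {1..n}))"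
    by (simp only: map_pmf_Tam_step[OF row_chain_mem])
  also have "\<dots> = map_pmf (perm_of n) (bind_pmf (map_pmf (\<lambda>\<xi>. row_chain n \<xi> k) ?R)
      (\<lambda>x. map_pmf (drop_step x) (coin_field p {1..n})))"
    by (simp add: bind_map_pmf map_bind_pmf map_pmf_comp)
  also have "bind_pmf (map_pmf (\<lambda>\<xi>. row_chain n \<xi> k) ?R)
      (\<lambda>x. map_pmf (drop_step x) (coin_field p {1..n})) =
      map_pmf (\<lambda>\<xi>. row_chain n \<xi> (Suc k)) (coin_field p ({..<Suc k} \<times> {1..n}))"
    by (rule map_pmf_driven_chain_Suc[symmetric]) simp_all
  also have "map_pmf (perm_of n) \<dots> =
      map_pmf (\<lambda>\<xi>. perm_of n (row_chain n \<xi> (Suc k))) (coin_field p ({..<Suc k} \<times> {1..n}))"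
    unfolding map_pmf_comp ..
  finally show ?case .
qed

section \<open>From the infinite product of coins to finite coin fields\<close>

lemma
  fixes q :: "'i \<Rightarrow> 'b :: finite pmf"
  assumes J: "finite J" "J \<subseteq> I"
  defines "C \<equiv> PiM I (\<lambda>i. measure_pmf (q i))"
  shows measurable_finite_coordinates:
      "{\<omega> \<in> space C. Q (\<lambda>j. if j \<in> J then \<omega> j else d)} \<in> sets C" (is ?meas)
    and emeasure_finite_coordinates:
      "emeasure C {\<omega> \<in> space C. Q (\<lambda>j. if j \<in> J then \<omega> j else d)} =
       emeasure (measure_pmf (Pi_pmf J d q)) {f. Q f}" (is ?eq)
proof -
  interpret product_prob_space "\<lambda>i. measure_pmf (q i)" I
    by (unfold_locales)
  \<comment> \<open>An event that depends on the coordinates in \<open>J\<close> only is the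
    disjoint union of the cylinders \<open>E f\<close> over the finitely many patterns
    \<open>f\<close> on \<open>J\<close> satisfying \<open>Q\<close>. Both measures give a cylinder
    the same product of point masses.\<close>
  define S where "S = {f \<in> PiE_dflt J d (\<lambda>_. UNIV :: 'b set). Q f}"
  define E where "E f = {\<omega> \<in> space C. \<forall>j\<in>J. \<omega> j \<in> {f j}}" for f
  have fin: "finite S"
    unfolding S_def by (rule finite_subset[OF _ finite_PiE_dflt[of J "\<lambda>_. UNIV" d]]) (use J in auto)
  have E: "E f \<in> sets C" for f
    unfolding E_def
  proof (rule sets.sets_Collect_finite_All[OF _ J(1)])
    fix j assume "j \<in> J"
    with J have "(\<lambda>\<omega>. \<omega> j) \<in> measurable C (measure_pmf (q j))"
      unfolding C_def by (intro measurable_component_singleton) blast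
    from measurable_sets[OF this, of "{f j}"] show "{\<omega> \<in> space C. \<omega> j \<in> {f j}} \<in> sets C"
      by (simp add: vimage_def Int_def conj_commute)
  qed
  have eq: "{\<omega> \<in> space C. Q (\<lambda>j. if j \<in> J then \<omega> j else d)} = (\<Union>f\<in>S. E f)"
  proof
    show "{\<omega> \<in> space C. Q (\<lambda>j. if j \<in> J then \<omega> j else d)} \<subseteq> (\<Union>f\<in>S. E f)"
    proof
      fix \<omega> assume "\<omega> \<in> {\<omega> \<in> space C. Q (\<lambda>j. if j \<in> J then \<omega> j else d)}"
      then have "(\<lambda>j. if j \<in> J then \<omega> j else d) \<in> S" "\<omega> \<in> E (\<lambda>j. if j \<in> J then \<omega> j else d)"
        by (auto simp: S_def E_def PiE_dflt_def)
      then show "\<omega> \<in> (\<Union>f\<in>S. E f)" by blast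
    qed
    show "(\<Union>f\<in>S. E f) \<subseteq> {\<omega> \<in> space C. Q (\<lambda>j. if j \<in> J then \<omega> j else d)}"
    proof
      fix \<omega> assume "\<omega> \<in> (\<Union>f\<in>S. E f)"
      then obtain f where f: "f \<in> S" "\<omega> \<in> E f" by blast
      then have "(\<lambda>j. if j \<in> J then \<omega> j else d) = f"
        by (auto simp: S_def E_def PiE_dflt_def fun_eq_iff)
      with f show "\<omega> \<in> {\<omega> \<in> space C. Q (\<lambda>j. if j \<in> J then \<omega> j else d)}"
        by (auto simp: S_def E_def)
    qed
  qed
  show ?meas unfolding eq using fin E by blast
  have disj: "disjoint_family_on E S"
    unfolding disjoint_family_on_def
  proof (intro ballI impI)
    fix f g assume fg: "f \<in> S" "g \<in> S" "f \<noteq> g"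
    then obtain j where "f j \<noteq> g j" by auto
    moreover from this fg have "j \<in> J" by (auto simp: S_def PiE_dflt_def)
    ultimately show "E f \<inter> E g = {}" by (auto simp: E_def)
  qed
  have pmf: "emeasure C (E f) = ennreal (pmf (Pi_pmf J d q) f)" if "f \<in> S" for f
  proof -
    have "emeasure C (E f) = (\<Prod>j\<in>J. emeasure (measure_pmf (q j)) {f j})"
      unfolding E_def C_def by (rule emeasure_PiM_Collect) (use J in auto)
    also have "\<dots> = ennreal (\<Prod>j\<in>J. pmf (q j) (f j))"
      by (simp add: emeasure_pmf_single prod_ennreal)
    also have "(\<Prod>j\<in>J. pmf (q j) (f j)) = pmf (Pi_pmf J d q) f"
      using that J by (subst pmf_Pi') (auto simp: S_def PiE_dflt_def)
    finally show ?thesis .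
  qed
  have "emeasure C (\<Union>f\<in>S. E f) = (\<Sum>f\<in>S. emeasure C (E f))"
    by (rule sum_emeasure[symmetric]) (use fin E disj in auto)
  also have "\<dots> = (\<Sum>f\<in>S. ennreal (pmf (Pi_pmf J d q) f))"
    by (rule sum.cong) (auto simp: pmf)
  also have "\<dots> = emeasure (measure_pmf (Pi_pmf J d q)) S"
    using fin by (simp add: emeasure_measure_pmf_finite)
  also have "\<dots> = emeasure (measure_pmf (Pi_pmf J d q)) {f. Q f}"
  proof (rule emeasure_eq_AE)
    have "f \<in> S \<longleftrightarrow> f \<in> {f. Q f}" if "f \<in> set_pmf (Pi_pmf J d q)" for f
      using that set_Pi_pmf_subset[of J d q] J by (auto simp: S_def PiE_dflt_def)
    then show "AE f in measure_pmf (Pi_pmf J d q). f \<in> S \<longleftrightarrow> f \<in> {f. Q f}"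
      by (simp add: AE_measure_pmf_iff)
  qed auto
  finally show ?eq unfolding eq .
qed

text \<open>This puts events about the state at time \<open>k\<close> into the form required by the
  cylinder lemma.\<close>

lemma ungarian_chain_coordinates:
  "ungarian_chain L (\<lambda>j. if j \<in> {..<k} \<times> carrier L then \<omega> j else False) k = ungarian_chain L \<omega> k"
proof -
  have cong: "ungarian_chain L \<omega> j = ungarian_chain L \<omega>' j"
    if "\<And>l y. l < j \<Longrightarrow> y \<in> carrier L \<Longrightarrow> \<omega> (l, y) = \<omega>' (l, y)" for \<omega> \<omega>' j
    using that
  proof (induction j)
    case (Suc j)
    have "ungarian_chain L \<omega> j = ungarian_chain L \<omega>' j"
      by (rule Suc.IH) (rule Suc.prems, simp_all)
    moreover have "{y \<in> lower_covers L x. \<omega> (j, y)} = {y \<in> lower_covers L x. \<omega>' (j, y)}" for x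
      using Suc.prems[of j] by (auto simp: lower_covers_def)
    ultimately show ?case by (simp add: Let_def)
  qed simp
  show ?thesis by (rule cong) simp
qed

text \<open>Every time before the first visit to the bottom contributes 1 to the sum. If the bottom
  is never visited, both sides are infinite.\<close>

lemma ungarian_steps_le:
  "ungarian_steps L \<omega> \<le> (\<Sum>k. indicator {k. ungarian_chain L \<omega> k \<noteq> \<bottom>\<^bsub>L\<^esub>} k)"
proof (cases "\<exists>k. ungarian_chain L \<omega> k = \<bottom>\<^bsub>L\<^esub>")
  case True
  define m where "m = (LEAST k. ungarian_chain L \<omega> k = \<bottom>\<^bsub>L\<^esub>)"
  have m: "ungarian_chain L \<omega> m = \<bottom>\<^bsub>L\<^esub>"
    unfolding m_def using True by (rule LeastI_ex)
  have least: "ungarian_chain L \<omega> k \<noteq> \<bottom>\<^bsub>L\<^esub>" if "k < m" for k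
    using that not_less_Least unfolding m_def by blast
  have "ungarian_steps L \<omega> \<le> of_nat m"
    unfolding ungarian_steps_def by (rule INF_lower) (simp add: m)
  also have "\<dots> = (\<Sum>k<m. 1 :: ennreal)" by simp
  also have "\<dots> = (\<Sum>k<m. indicator {k. ungarian_chain L \<omega> k \<noteq> \<bottom>\<^bsub>L\<^esub>} k)"
    by (rule sum.cong) (use least in auto)
  also have "\<dots> \<le> (\<Sum>k. indicator {k. ungarian_chain L \<omega> k \<noteq> \<bottom>\<^bsub>L\<^esub>} k)"
    by (rule sum_le_suminf) auto
  finally show ?thesis .
next
  case False
  have "of_nat m \<le> (\<Sum>k. 1 :: ennreal)" for m
  proof -
    have "of_nat m = (\<Sum>k<m. 1 :: ennreal)" by simp
    also have "\<dots> \<le> (\<Sum>k. 1)" by (rule sum_le_suminf) auto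
    finally show ?thesis .
  qed
  then have "(\<Sum>k. 1 :: ennreal) = \<top>"
    by (metis ennreal_Ex_less_of_nat less_top not_le)
  moreover have "(\<Sum>k. indicator {k. ungarian_chain L \<omega> k \<noteq> \<bottom>\<^bsub>L\<^esub>} k :: ennreal) = (\<Sum>k. 1)"
    using False by (intro suminf_cong) auto
  ultimately show ?thesis by simp
qed

lemma ungarian_expectation_le:
  assumes "finite (carrier L)"
  shows "ungarian_expectation p L \<le>
    (\<Sum>k. emeasure (measure_pmf (coin_field p ({..<k} \<times> carrier L)))
      {\<omega>. ungarian_chain L \<omega> k \<noteq> \<bottom>\<^bsub>L\<^esub>})"
proof -
  define C where "C = ungarian_coins p L"
  define E where "E k = {\<omega> \<in> space C. ungarian_chain L \<omega> k \<noteq> \<bottom>\<^bsub>L\<^esub>}" for k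
  have E_eq: "E k = {\<omega> \<in> space C. ungarian_chain L (\<lambda>j. if j \<in> {..<k} \<times> carrier L then \<omega> j else False) k \<noteq> \<bottom>\<^bsub>L\<^esub>}" for k
    unfolding E_def ungarian_chain_coordinates ..
  have [measurable]: "E k \<in> sets C" for k
    unfolding E_eq C_def ungarian_coins_def
    by (rule measurable_finite_coordinates) (use assms in auto)
  have em: "emeasure C (E k) = emeasure (measure_pmf (coin_field p ({..<k} \<times> carrier L)))
      {\<omega>. ungarian_chain L \<omega> k \<noteq> \<bottom>\<^bsub>L\<^esub>}" for k
    unfolding E_eq C_def ungarian_coins_def
    by (rule emeasure_finite_coordinates) (use assms in auto)
  have "ungarian_expectation p L \<le> (\<integral>\<^sup>+ \<omega>. (\<Sum>k. indicator (E k) \<omega>) \<partial>C)"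
    unfolding ungarian_expectation_def C_def[symmetric]
  proof (rule nn_integral_mono)
    fix \<omega> assume "\<omega> \<in> space C"
    then have "(\<Sum>k. indicator {k. ungarian_chain L \<omega> k \<noteq> \<bottom>\<^bsub>L\<^esub>} k :: ennreal) = (\<Sum>k. indicator (E k) \<omega>)"
      by (intro suminf_cong) (auto simp: E_def indicator_def)
    then show "ungarian_steps L \<omega> \<le> (\<Sum>k. indicator (E k) \<omega>)"
      using ungarian_steps_le[of L \<omega>] by simp
  qed
  also have "\<dots> = (\<Sum>k. emeasure C (E k))"
    by (subst nn_integral_suminf) auto
  finally show ?thesis unfolding em .
qed

lemma ungarian_expectation_Tam_le:
  "ungarian_expectation p (Tam n) \<le>
    (\<Sum>k. ennreal (measure_pmf.prob (coin_field p ({..<k} \<times> {1..n})) {\<xi>. row_chain n \<xi> k \<noteq> (\<lambda>a. a)}))"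
proof -
  have eq: "emeasure (measure_pmf (coin_field p ({..<k} \<times> carrier (Tam n))))
      {\<omega>. ungarian_chain (Tam n) \<omega> k \<noteq> \<bottom>\<^bsub>Tam n\<^esub>} =
    ennreal (measure_pmf.prob (coin_field p ({..<k} \<times> {1..n})) {\<xi>. row_chain n \<xi> k \<noteq> (\<lambda>a. a)})" for k
  proof -
    have "emeasure (measure_pmf (coin_field p ({..<k} \<times> Av312 n)))
        {\<omega>. ungarian_chain (Tam n) \<omega> k \<noteq> \<bottom>\<^bsub>Tam n\<^esub>} =
      emeasure (map_pmf (\<lambda>\<omega>. ungarian_chain (Tam n) \<omega> k) (coin_field p ({..<k} \<times> Av312 n)))
        {x. x \<noteq> \<bottom>\<^bsub>Tam n\<^esub>}"
      by simp
    also have "\<dots> = emeasure (measure_pmf (coin_field p ({..<k} \<times> {1..n})))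
        {\<xi>. perm_of n (row_chain n \<xi> k) \<noteq> \<bottom>\<^bsub>Tam n\<^esub>}"
      unfolding map_pmf_ungarian_chain_Tam by simp
    also have "{\<xi>. perm_of n (row_chain n \<xi> k) \<noteq> \<bottom>\<^bsub>Tam n\<^esub>} = {\<xi>. row_chain n \<xi> k \<noteq> (\<lambda>a. a)}"
      unfolding bottom_Tam perm_of_eq_iff[OF row_chain_mem id_mem_bracket_vectors] ..
    finally show ?thesis by (simp add: measure_pmf.emeasure_eq_measure)
  qed
  have "finite (carrier (Tam n))" by (simp add: finite_Av312)
  from ungarian_expectation_le[OF this, of p] show ?thesis unfolding eq .
qed

section \<open>The mean of the largest gap\<close>

text \<open>A number of successes per row that suffices when \<open>a\<close> is the row with the
  latest first success and \<open>b\<close> the latest among the rows below \<open>a\<close>. The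
  three terms serve the rows from \<open>a\<close> on, the rows from \<open>b\<close> to
  \<open>a - 1\<close>, and the rows below \<open>b\<close>.\<close>

definition gap_width :: "nat \<Rightarrow> nat \<Rightarrow> nat \<Rightarrow> nat" where
  "gap_width n a b = max (Suc n - a) (max (a - b) b)"

text \<open>For \<open>b\<close> uniform below \<open>a\<close>, the larger of the two parts
  \<open>a - b\<close> and \<open>b\<close> has mean about 3/4 of \<open>a\<close>. In the induction
  by steps of two, the outermost terms \<open>b = 1\<close> and \<open>b = a + 1\<close> both equal
  \<open>a + 1\<close>, and every inner term is an old term plus 1.\<close>

lemma sum_max_reflect:
  "(\<Sum>b=1..<a. real (max (a - b) b)) \<le> 3 / 4 * real a * (real a - 1)"
proof (induction a rule: nat_induct2)
  case (step a)
  show ?case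
  proof (cases "a = 0")
    case False
    have "{1..<a + 2} = insert 1 (insert (a + 1) (Suc ` {1..<a}))"
      using False by (auto simp: image_iff less_Suc_eq_0_disj) presburger
    also have "(\<Sum>b\<in>\<dots>. real (max (a + 2 - b) b)) =
        2 * (real a + 1) + (\<Sum>b\<in>Suc ` {1..<a}. real (max (a + 2 - b) b))"
      using False by (subst sum.insert; force)+
    also have "(\<Sum>b\<in>Suc ` {1..<a}. real (max (a + 2 - b) b)) = (\<Sum>b=1..<a. real (max (a - b) b) + 1)"
      by (subst sum.reindex) (auto intro!: sum.cong simp: max_def of_nat_diff)
    also have "\<dots> = (\<Sum>b=1..<a. real (max (a - b) b)) + (real a - 1)"
      using False by (simp add: sum.distrib of_nat_diff)
    finally show ?thesis using step by (simp add: algebra_simps)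
  qed simp
qed simp_all

text \<open>
  In the middle range the width is bounded by the chord of the convex function
  \<open>m \<mapsto> max (n - a) m\<close> on \<open>[a/2, a]\<close>.
\<close>

lemma sum_max_three_gaps:
  assumes "1 \<le> a" "a \<le> n"
  shows "(\<Sum>b=1..<a. max (real n - real a) (real (max (a - b) b))) \<le>
    (real a - 1) * max (real n - real a) (max (real n / 2) (3 / 4 * real a))"
proof -
  define S where "S = (\<Sum>b=1..<a. real (max (a - b) b))"
  have S: "S \<le> 3 / 4 * real a * (real a - 1)"
    unfolding S_def by (rule sum_max_reflect)
  have card: "(\<Sum>b=1..<a. c) = (real a - 1) * c" for c
    using assms by (simp add: of_nat_diff)
  \<comment> \<open>In the first case \<open>n - a\<close> dominates both parts of \<open>a\<close>;
    in the second it is at most \<open>a / 2\<close> and hence at most the larger part. Only the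
    third case mixes the two.\<close>
  consider "2 * a \<le> n" | "2 * n \<le> 3 * a" | "n < 2 * a" "3 * a < 2 * n" by linarith
  then show ?thesis
  proof cases
    case 1
    have "(\<Sum>b=1..<a. max (real n - real a) (real (max (a - b) b))) \<le> (\<Sum>b=1..<a. real n - real a)"
      by (rule sum_mono) (use 1 in auto)
    also have "\<dots> = (real a - 1) * (real n - real a)" by (rule card)
    also have "\<dots> \<le> (real a - 1) * max (real n - real a) (max (real n / 2) (3 / 4 * real a))"
      using assms by (intro mult_left_mono) (auto simp: le_max_iff_disj)
    finally show ?thesis .
  next
    case 2
    have "(\<Sum>b=1..<a. max (real n - real a) (real (max (a - b) b))) \<le> S"
      unfolding S_def by (rule sum_mono) (use 2 in \<open>auto simp: max_def of_nat_diff\<close>)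
    also have "\<dots> \<le> (real a - 1) * (3 / 4 * real a)" using S by (simp add: algebra_simps)
    also have "\<dots> \<le> (real a - 1) * max (real n - real a) (max (real n / 2) (3 / 4 * real a))"
      using assms by (intro mult_left_mono) (auto simp: le_max_iff_disj)
    finally show ?thesis .
  next
    case 3
    \<comment> \<open>Half the slope of the chord, which has the value \<open>n - a\<close> at
      \<open>m = a / 2\<close> and the value \<open>a\<close> at \<open>m = a\<close>.\<close>
    define s where "s = (2 * real a - real n) / real a"
    have a: "real a > 0" using assms by simp
    have s: "s \<ge> 0" "s \<le> 1" "s * real a = 2 * real a - real n"
      using 3 assms a by (auto simp: s_def field_simps)
    have chord: "max (real n - real a) (real (max (a - b) b)) \<le>
        (real n - real a) + s * (2 * real (max (a - b) b) - real a)" if "b \<in> {1..<a}" for b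
    proof -
      define m where "m = real (max (a - b) b)"
      have m: "real a \<le> 2 * m" "m \<le> real a"
        using that by (auto simp: m_def max_def of_nat_diff)
      have "0 \<le> s * (2 * m - real a)" using s m by simp
      moreover have "m \<le> (real n - real a) + s * (2 * m - real a)"
      proof -
        have "(real n - real a) + s * (2 * m - real a) - m = (1 - 2 * s) * (real a - m)"
          using s(3) by (simp add: algebra_simps)
        \<comment> \<open>The left end of the chord lies above the diagonal: \<open>n - a\<close> is
          at least \<open>a / 2\<close>, that is, \<open>3 * a \<le> 2 * n\<close>.\<close>
        moreover have "2 * s \<le> 1"
        proof -
          have "real (3 * a) < real (2 * n)" using 3 by (simp only: of_nat_less_iff)
          then have "2 * (2 * real a - real n) \<le> real a" by simp
          then show ?thesis using a by (simp add: s_def field_simps)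
        qed
        moreover have "0 \<le> (1 - 2 * s) * (real a - m)"
          using \<open>2 * s \<le> 1\<close> m by (intro mult_nonneg_nonneg) simp_all
        ultimately show ?thesis by linarith
      qed
      ultimately show ?thesis unfolding m_def[symmetric] by simp
    qed
    have "(\<Sum>b=1..<a. max (real n - real a) (real (max (a - b) b))) \<le>
        (\<Sum>b=1..<a. (real n - real a) + s * (2 * real (max (a - b) b) - real a))"
      by (rule sum_mono) (rule chord)
    also have "\<dots> = (real a - 1) * (real n - real a) + s * (2 * S - (real a - 1) * real a)"
      by (simp only: sum.distrib sum_subtractf card sum_distrib_left[symmetric] S_def)
         (simp add: right_diff_distrib)
    also have "\<dots> \<le> (real a - 1) * (real n - real a) + s * ((real a - 1) * real a / 2)"
      using S s(1) by (intro add_left_mono mult_left_mono) (auto simp: algebra_simps)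
    also have "\<dots> = (real a - 1) * (real n - real a) + (real a - 1) * (s * real a) / 2"
      by simp
    also have "\<dots> = (real a - 1) * (real n / 2)"
      unfolding s(3) by (simp add: field_simps)
    also have "\<dots> \<le> (real a - 1) * max (real n - real a) (max (real n / 2) (3 / 4 * real a))"
      using assms by (intro mult_left_mono) (auto simp: le_max_iff_disj)
    finally show ?thesis .
  qed
qed

text \<open>A right-endpoint Riemann sum of a decreasing function, compared with the area of the
  triangle under it. The induction removes the first term and replaces \<open>x\<close> by
  \<open>x - 1\<close>.\<close>

lemma sum_positive_part_le:
  fixes x :: real
  assumes "x \<ge> 0"
  shows "(\<Sum>a=1..m. max 0 (x - real a)) \<le> x\<^sup>2 / 2"
  using assms
proof (induction m arbitrary: x)
  case (Suc m)
  have split: "(\<Sum>a=1..Suc m. max 0 (x - real a)) = max 0 (x - 1) + (\<Sum>a=1..m. max 0 ((x - 1) - real a))"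
    by (subst sum.atLeast_Suc_atMost, simp, subst sum.atLeast_Suc_atMost_Suc_shift)
       (simp add: algebra_simps)
  show ?case
  proof (cases "x \<ge> 1")
    case True
    have "(\<Sum>a=1..m. max 0 ((x - 1) - real a)) \<le> (x - 1)\<^sup>2 / 2"
      by (rule Suc.IH) (use True in simp)
    then have "(\<Sum>a=1..Suc m. max 0 (x - real a)) \<le> (x - 1) + (x - 1)\<^sup>2 / 2"
      unfolding split using True by simp
    also have "\<dots> \<le> x\<^sup>2 / 2"
      by (simp add: power2_eq_square field_simps)
    finally show ?thesis .
  next
    case False
    then have "(\<Sum>a=1..Suc m. max 0 (x - real a)) = 0"
      by (intro sum.neutral) auto
    then show ?thesis by (simp only:) simp
  qed
qed simp

text \<open>With \<open>a = t * n\<close>, the profile is the maximum of \<open>1 - t\<close>,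
  \<open>1/2\<close> and \<open>3 * t / 4\<close>. Its integral over the unit interval is 1/2 plus
  the two triangles 1/8 and 1/24, which gives 2/3.\<close>

lemma sum_max_profile:
  "(\<Sum>a=1..n. max (real n - real a) (max (real n / 2) (3 / 4 * real a))) \<le>
    2 / 3 * (real n)\<^sup>2 + real n / 4"
proof -
  have "(\<Sum>a=1..n. max (real n - real a) (max (real n / 2) (3 / 4 * real a))) \<le>
    (\<Sum>a=1..n. real n / 2 + max 0 (real n / 2 - real a) + max 0 (3 / 4 * real a - real n / 2))"
    by (rule sum_mono) (auto simp: max_def)
  also have "\<dots> = real n * (real n / 2) + (\<Sum>a=1..n. max 0 (real n / 2 - real a)) +
      (\<Sum>a=1..n. max 0 (3 / 4 * real a - real n / 2))"
    by (simp add: sum.distrib)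
  also have "(\<Sum>a=1..n. max 0 (real n / 2 - real a)) \<le> (real n / 2)\<^sup>2 / 2"
    by (rule sum_positive_part_le) simp
  \<comment> \<open>Reflecting \<open>a = n - j\<close> turns the right triangle into the form of
    \<open>sum_positive_part_le\<close>; the term \<open>j = 0\<close> accounts for
    \<open>n / 4\<close>.\<close>
  also have "(\<Sum>a=1..n. max 0 (3 / 4 * real a - real n / 2)) \<le> real n / 4 + 3 / 4 * ((real n / 3)\<^sup>2 / 2)"
  proof (cases "n = 0")
    case False
    have "(\<Sum>a=1..n. max 0 (3 / 4 * real a - real n / 2)) =
        (\<Sum>j=0..<n. max 0 (3 / 4 * real (n - j) - real n / 2))"
      by (rule sum.reindex_bij_witness[of _ "\<lambda>j. n - j" "\<lambda>a. n - a"]) auto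
    also have "\<dots> = (\<Sum>j=0..<n. 3 / 4 * max 0 (real n / 3 - real j))"
      by (rule sum.cong) (auto simp: max_def of_nat_diff field_simps)
    also have "\<dots> = 3 / 4 * (real n / 3 + (\<Sum>j=1..<n. max 0 (real n / 3 - real j)))"
      unfolding sum_distrib_left[symmetric] using False by (simp add: sum.atLeast_Suc_lessThan)
    also have "{1..<n} = {1..n - 1}" using False by auto
    also have "(\<Sum>j=1..n - 1. max 0 (real n / 3 - real j)) \<le> (real n / 3)\<^sup>2 / 2"
      by (rule sum_positive_part_le) simp
    finally show ?thesis by simp
  qed simp
  finally show ?thesis by (simp add: power2_eq_square field_simps)
qed

text \<open>The weights are the joint probabilities of the pair when \<open>a\<close> is uniform on
  \<open>{1..n}\<close> and \<open>b\<close> uniform below \<open>a\<close>; there is no such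
  \<open>b\<close> for \<open>a = 1\<close>. The shift \<open>c\<close> makes room for rounding
  terms.\<close>

lemma sum_gap_width_le:
  assumes "n \<ge> 1"
  shows "(\<Sum>a=2..n. \<Sum>b=1..<a. (real (gap_width n a b) + c) / (real n * (real a - 1))) \<le>
    2 / 3 * real n + 5 / 4 + \<bar>c\<bar>"
proof -
  let ?h = "\<lambda>a. max (real n - real a) (max (real n / 2) (3 / 4 * real a))"
  have "(\<Sum>b=1..<a. (real (gap_width n a b) + c) / (real n * (real a - 1))) \<le> ?h a / real n + (1 + \<bar>c\<bar>) / real n"
    if a: "a \<in> {2..n}" for a
  proof -
    have pos: "real a - 1 > 0" "real n > 0" using a by auto
    have "(\<Sum>b=1..<a. real (gap_width n a b) + c) \<le>
        (\<Sum>b=1..<a. max (real n - real a) (real (max (a - b) b)) + (1 + \<bar>c\<bar>))"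
      by (rule sum_mono) (use a in \<open>auto simp: gap_width_def max_def of_nat_diff\<close>)
    also have "\<dots> \<le> (real a - 1) * ?h a + (real a - 1) * (1 + \<bar>c\<bar>)"
      using sum_max_three_gaps[of a n] a by (simp add: sum.distrib of_nat_diff)
    finally have "(\<Sum>b=1..<a. real (gap_width n a b) + c) / (real n * (real a - 1)) \<le>
        ((real a - 1) * ?h a + (real a - 1) * (1 + \<bar>c\<bar>)) / (real n * (real a - 1))"
      using pos by (intro divide_right_mono) auto
    also have "\<dots> = ?h a / real n + (1 + \<bar>c\<bar>) / real n"
      using pos by (simp add: field_simps)
    finally show ?thesis by (simp add: sum_divide_distrib)
  qed
  then have "(\<Sum>a=2..n. \<Sum>b=1..<a. (real (gap_width n a b) + c) / (real n * (real a - 1))) \<le>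
      (\<Sum>a=2..n. ?h a / real n + (1 + \<bar>c\<bar>) / real n)"
    by (rule sum_mono)
  also have "\<dots> \<le> (\<Sum>a=1..n. ?h a / real n + (1 + \<bar>c\<bar>) / real n)"
    by (rule sum_mono2) auto
  also have "\<dots> = (\<Sum>a=1..n. ?h a) / real n + (1 + \<bar>c\<bar>)"
    using assms by (simp add: sum.distrib sum_divide_distrib)
  also have "\<dots> \<le> (2 / 3 * (real n)\<^sup>2 + real n / 4) / real n + (1 + \<bar>c\<bar>)"
    by (intro add_right_mono divide_right_mono sum_max_profile) simp
  also have "\<dots> = 2 / 3 * real n + 5 / 4 + \<bar>c\<bar>"
    using assms by (simp add: power2_eq_square add_divide_distrib)
  finally show ?thesis .
qed

section \<open>Exchangeable first successes\<close>

definition argmax_at :: "nat set \<Rightarrow> nat \<Rightarrow> (nat \<Rightarrow> 'k :: linorder) set" where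
  "argmax_at S a = {f. \<forall>c\<in>S - {a}. f c < f a}"

lemma comp_mem_argmax_at_iff:
  assumes "bij_betw \<tau> S S" "a \<in> S"
  shows "f \<circ> \<tau> \<in> argmax_at S a \<longleftrightarrow> f \<in> argmax_at S (\<tau> a)"
proof -
  have "\<tau> ` (S - {a}) = S - {\<tau> a}"
    using assms by (auto simp: bij_betw_def inj_on_def image_iff)
  then have "(\<forall>c\<in>S - {\<tau> a}. f c < f (\<tau> a)) \<longleftrightarrow> (\<forall>c\<in>\<tau> ` (S - {a}). f c < f (\<tau> a))"
    by simp
  then show ?thesis by (simp add: argmax_at_def)
qed

lemma bij_betw_transpose:
  assumes "a \<in> S" "b \<in> S"
  shows "bij_betw (Transposition.transpose a b) S S"
  using permutes_imp_bij[OF permutes_swap_id[OF assms]] .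

lemma ex_argmax_at:
  fixes f :: "nat \<Rightarrow> 'k :: linorder"
  assumes S: "finite S" "S \<noteq> {}" and inj: "inj_on f S"
  shows "\<exists>a\<in>S. f \<in> argmax_at S a"
proof -
  have "Max (f ` S) \<in> f ` S" using S by (intro Max_in) auto
  then obtain a where a: "a \<in> S" "f a = Max (f ` S)" by auto
  have "f c < f a" if c: "c \<in> S - {a}" for c
  proof -
    have "f c \<le> f a" unfolding a(2) using S c by (intro Max_ge) auto
    moreover have "f c \<noteq> f a"
      using inj_on_contraD[OF inj, of c a] a(1) c by blast
    ultimately show ?thesis by simp
  qed
  with a(1) show ?thesis by (auto simp: argmax_at_def)
qed

text \<open>Transposing two points of \<open>S\<close> preserves the law and the event
  \<open>U\<close>, so the maximum over \<open>S\<close> is equally likely at each point within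
  \<open>U\<close>. These events are disjoint, and by injectivity they exhaust \<open>U\<close> on
  the support.\<close>

lemma prob_Int_argmax_at:
  fixes D :: "(nat \<Rightarrow> 'k :: linorder) pmf"
  assumes S: "finite S" and a: "a \<in> S"
    and inj: "\<And>f. f \<in> set_pmf D \<Longrightarrow> inj_on f S"
    and exch: "\<And>i j. i \<in> S \<Longrightarrow> j \<in> S \<Longrightarrow> map_pmf (\<lambda>f. f \<circ> Transposition.transpose i j) D = D"
    and U: "\<And>i j f. i \<in> S \<Longrightarrow> j \<in> S \<Longrightarrow> f \<circ> Transposition.transpose i j \<in> U \<longleftrightarrow> f \<in> U"
  shows "measure_pmf.prob D (U \<inter> argmax_at S a) = measure_pmf.prob D U / card S"
proof -
  have same: "measure_pmf.prob D (U \<inter> argmax_at S b) = measure_pmf.prob D (U \<inter> argmax_at S a)"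
    if "b \<in> S" for b
  proof -
    let ?t = "Transposition.transpose b a"
    have "measure_pmf.prob D (U \<inter> argmax_at S b) =
        measure_pmf.prob (map_pmf (\<lambda>f. f \<circ> ?t) D) (U \<inter> argmax_at S b)"
      using exch[OF that a] by simp
    also have "\<dots> = measure_pmf.prob D {f. f \<circ> ?t \<in> U \<inter> argmax_at S b}"
      by (simp add: vimage_def)
    also have "{f. f \<circ> ?t \<in> U \<inter> argmax_at S b} = U \<inter> argmax_at S a"
      using U[OF that a] comp_mem_argmax_at_iff[OF bij_betw_transpose[OF that a] that] by auto
    finally show ?thesis .
  qed
  have "measure_pmf.prob D U = measure_pmf.prob D (\<Union>b\<in>S. U \<inter> argmax_at S b)"
  proof (rule measure_pmf.finite_measure_eq_AE)
    have "f \<in> U \<longleftrightarrow> f \<in> (\<Union>b\<in>S. U \<inter> argmax_at S b)" if "f \<in> set_pmf D" for f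
      using ex_argmax_at[OF S _ inj[OF that]] a by blast
    then show "AE f in measure_pmf D. f \<in> U \<longleftrightarrow> f \<in> (\<Union>b\<in>S. U \<inter> argmax_at S b)"
      by (simp add: AE_measure_pmf_iff)
  qed auto
  also have "\<dots> = (\<Sum>b\<in>S. measure_pmf.prob D (U \<inter> argmax_at S b))"
  proof (rule measure_pmf.finite_measure_finite_Union[OF S])
    show "disjoint_family_on (\<lambda>b. U \<inter> argmax_at S b) S"
      unfolding disjoint_family_on_def
    proof (intro ballI impI)
      fix b c assume "b \<in> S" "c \<in> S" "b \<noteq> c"
      then have "f \<notin> argmax_at S b \<inter> argmax_at S c" for f :: "nat \<Rightarrow> 'k"
        using less_asym[of "f b" "f c"] by (auto simp: argmax_at_def)
      then show "(U \<inter> argmax_at S b) \<inter> (U \<inter> argmax_at S c) = {}" by blast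
    qed
  qed auto
  also have "\<dots> = (\<Sum>b\<in>S. measure_pmf.prob D (U \<inter> argmax_at S a))"
    by (rule sum.cong) (auto simp: same)
  finally have "measure_pmf.prob D U = card S * measure_pmf.prob D (U \<inter> argmax_at S a)" by simp
  moreover have "card S > 0" using S a by (auto simp: card_gt_0_iff)
  ultimately show ?thesis by (simp add: field_simps)
qed

text \<open>The second claim conditions on the first: transpositions within \<open>{1..<a}\<close>
  fix \<open>a\<close> and hence preserve the event that the overall maximum is at \<open>a\<close>.
  So the maximum over \<open>{1..<a}\<close> is still uniform there.\<close>

lemma
  fixes D :: "(nat \<Rightarrow> 'k :: linorder) pmf"
  assumes inj: "\<And>f. f \<in> set_pmf D \<Longrightarrow> inj_on f {1..n}"
    and exch: "\<And>i j. i \<in> {1..n} \<Longrightarrow> j \<in> {1..n} \<Longrightarrow> map_pmf (\<lambda>f. f \<circ> Transposition.transpose i j) D = D"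
    and a: "a \<in> {1..n}"
  shows prob_argmax_at: "measure_pmf.prob D (argmax_at {1..n} a) = 1 / n"
    and prob_two_argmax_at: "b \<in> {1..<a} \<Longrightarrow>
      measure_pmf.prob D (argmax_at {1..n} a \<inter> argmax_at {1..<a} b) = 1 / (real n * (real a - 1))"
proof -
  show one: "measure_pmf.prob D (argmax_at {1..n} a) = 1 / n"
    using prob_Int_argmax_at[of "{1..n}" a D UNIV] assms by simp
  assume b: "b \<in> {1..<a}"
  have "measure_pmf.prob D (argmax_at {1..n} a \<inter> argmax_at {1..<a} b) =
      measure_pmf.prob D (argmax_at {1..n} a) / card {1..<a}"
  proof (rule prob_Int_argmax_at)
    fix i j and f :: "nat \<Rightarrow> 'k" assume ij: "i \<in> {1..<a}" "j \<in> {1..<a}"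
    then have "i \<in> {1..n}" "j \<in> {1..n}" using a by auto
    from comp_mem_argmax_at_iff[OF bij_betw_transpose[OF this] a, of f]
    show "f \<circ> Transposition.transpose i j \<in> argmax_at {1..n} a \<longleftrightarrow> f \<in> argmax_at {1..n} a"
      using ij by (simp add: transpose_apply_other)
  next
    fix f assume "f \<in> set_pmf D"
    from inj[OF this] show "inj_on f {1..<a}"
      by (rule inj_on_subset) (use a in auto)
  next
    fix i j assume "i \<in> {1..<a}" "j \<in> {1..<a}"
    then show "map_pmf (\<lambda>f. f \<circ> Transposition.transpose i j) D = D"
      using a by (intro exch) auto
  qed (use b in auto)
  then show "measure_pmf.prob D (argmax_at {1..n} a \<inter> argmax_at {1..<a} b) = 1 / (real n * (real a - 1))"
    unfolding one using b by (simp add: of_nat_diff)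
qed

section \<open>First success times and the keys that order the rows\<close>

definition first_success :: "nat \<Rightarrow> (nat \<times> nat \<Rightarrow> bool) \<Rightarrow> nat \<Rightarrow> nat" where
  "first_success k \<xi> a = (LEAST j. k \<le> j \<or> \<xi> (j, a))"

text \<open>Translates the order of first successes, capped at \<open>k\<close>, into the condition
  under which \<open>row_chain_finished\<close> applies.\<close>

lemma first_success_mono_imp:
  assumes "first_success k \<xi> c \<le> first_success k \<xi> a" "j < k" "\<xi> (j, a)"
  shows "\<exists>i\<le>j. \<xi> (i, c)"
proof -
  have "first_success k \<xi> a \<le> j"
    unfolding first_success_def by (rule Least_le) (use assms in auto)
  then have "first_success k \<xi> c \<le> j" using assms by simp
  moreover have "k \<le> first_success k \<xi> c \<or> \<xi> (first_success k \<xi> c, c)"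
    unfolding first_success_def by (rule LeastI[of _ k]) simp
  ultimately show ?thesis using assms(2) by auto
qed

text \<open>Since \<open>\<sigma> a \<le> n\<close>, comparing keys compares the pairs (first success, tie-breaker) lexicographically.\<close>

definition row_key :: "nat \<Rightarrow> nat \<Rightarrow> (nat \<times> nat \<Rightarrow> bool) \<Rightarrow> (nat \<Rightarrow> nat) \<Rightarrow> nat \<Rightarrow> nat" where
  "row_key n k \<xi> \<sigma> a = first_success k \<xi> a * Suc n + \<sigma> a"

lemma row_key_less_imp:
  assumes "row_key n k \<xi> \<sigma> c < row_key n k \<xi> \<sigma> a" "\<sigma> permutes {1..n}" "a \<in> {1..n}"
  shows "first_success k \<xi> c \<le> first_success k \<xi> a"
proof (rule ccontr)
  assume "\<not> ?thesis"
  then have "Suc (first_success k \<xi> a) * Suc n \<le> first_success k \<xi> c * Suc n"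
    by (intro mult_le_mono1) simp
  moreover have "\<sigma> a \<in> {1..n}"
    using permutes_in_image[OF assms(2)] assms(3) by blast
  ultimately show False using assms(1) by (simp add: row_key_def)
qed

lemma inj_on_row_key:
  assumes "\<sigma> permutes {1..n}"
  shows "inj_on (row_key n k \<xi> \<sigma>) {1..n}"
proof (rule inj_onI)
  fix a b assume ab: "a \<in> {1..n}" "b \<in> {1..n}" "row_key n k \<xi> \<sigma> a = row_key n k \<xi> \<sigma> b"
  have "\<sigma> a \<in> {1..n}" "\<sigma> b \<in> {1..n}"
    using permutes_in_image[OF assms] ab(1,2) by blast+
  then have "row_key n k \<xi> \<sigma> a mod Suc n = \<sigma> a" "row_key n k \<xi> \<sigma> b mod Suc n = \<sigma> b"
    unfolding row_key_def by (simp_all only: mod_mult_self3 mod_mult_self4 atLeastAtMost_iff mod_less less_Suc_eq_le)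
  then have "\<sigma> a = \<sigma> b" using ab(3) by simp
  then show "a = b" using inj_eq[OF permutes_inj[OF assms]] by simp
qed

definition key_pmf :: "real \<Rightarrow> nat \<Rightarrow> nat \<Rightarrow> (nat \<Rightarrow> nat) pmf" where
  "key_pmf p n k = map_pmf (\<lambda>(\<xi>, \<sigma>). row_key n k \<xi> \<sigma>)
    (pair_pmf (coin_field p ({..<k} \<times> {1..n})) (pmf_of_set {\<sigma>. \<sigma> permutes {1..n}}))"

lemma set_pmf_of_set_permutes: "set_pmf (pmf_of_set {\<sigma>. \<sigma> permutes {1..n::nat}}) = {\<sigma>. \<sigma> permutes {1..n}}"
  using permutes_id[of "{1..n}"] by (intro set_pmf_of_set finite_permutations) blast+

lemma inj_on_key_pmf: "f \<in> set_pmf (key_pmf p n k) \<Longrightarrow> inj_on f {1..n}"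
  unfolding key_pmf_def set_map_pmf set_pair_pmf set_pmf_of_set_permutes
  by (erule imageE, erule SigmaE) (simp only: case_prod_conv mem_Collect_eq inj_on_row_key)

text \<open>Relabelling rows by \<open>t\<close> maps the independent coins and the uniform
  tie-breaker to themselves in law, and relabelling commutes with forming keys.\<close>

lemma key_pmf_exchangeable:
  assumes "i \<in> {1..n}" "j \<in> {1..n}"
  shows "map_pmf (\<lambda>f. f \<circ> Transposition.transpose i j) (key_pmf p n k) = key_pmf p n k"
proof -
  define t where "t = Transposition.transpose i j"
  have t: "t permutes {1..n}" unfolding t_def using assms by (rule permutes_swap_id)
  have tt: "t \<circ> t = id" unfolding t_def by simp
  have tin: "t a \<in> {1..n} \<longleftrightarrow> a \<in> {1..n}" for a by (rule permutes_in_image[OF t])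
  let ?P = "coin_field p ({..<k} \<times> {1..n})" and ?S = "{\<sigma>. \<sigma> permutes {1..n}}"
  have P: "map_pmf (\<lambda>\<xi>. \<xi> \<circ> map_prod id t) ?P = ?P"
  proof (rule Pi_pmf_bij_betw[symmetric])
    show "bij_betw (map_prod id t) ({..<k} \<times> {1..n}) ({..<k} \<times> {1..n})"
      by (rule bij_betw_map_prod) (use permutes_imp_bij[OF t] in auto)
    show "map_prod id t x \<notin> {..<k} \<times> {1..n}" if "x \<notin> {..<k} \<times> {1..n}" for x
      using that by (simp only: mem_Times_iff fst_map_prod snd_map_prod id_apply tin not_False_eq_True)
  qed simp
  have Q: "map_pmf (\<lambda>\<sigma>. \<sigma> \<circ> t) (pmf_of_set ?S) = pmf_of_set ?S"
  proof (rule map_pmf_of_set_bij_betw)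
    have *: "\<sigma> \<circ> t \<in> ?S" if "\<sigma> \<in> ?S" for \<sigma>
      using that permutes_compose[OF t] by simp
    have inv: "\<sigma> \<circ> t \<circ> t = \<sigma>" for \<sigma> :: "nat \<Rightarrow> nat"
      by (simp only: comp_assoc tt comp_id)
    show "bij_betw (\<lambda>\<sigma>. \<sigma> \<circ> t) ?S ?S"
      by (rule bij_betw_byWitness[of _ "\<lambda>\<sigma>. \<sigma> \<circ> t"]) (use * inv in auto)
    show "?S \<noteq> {}" using permutes_id by blast
    show "finite ?S" by (rule finite_permutations) simp
  qed
  have key: "row_key n k \<xi> \<sigma> \<circ> t = row_key n k (\<xi> \<circ> map_prod id t) (\<sigma> \<circ> t)" for \<xi> \<sigma>
    by (simp add: fun_eq_iff row_key_def first_success_def)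
  have "map_pmf (\<lambda>f. f \<circ> t) (key_pmf p n k) =
      map_pmf (\<lambda>(\<xi>, \<sigma>). row_key n k \<xi> \<sigma>)
        (map_pmf (\<lambda>(\<xi>, \<sigma>). (\<xi> \<circ> map_prod id t, \<sigma> \<circ> t)) (pair_pmf ?P (pmf_of_set ?S)))"
    unfolding key_pmf_def map_pmf_comp by (rule map_pmf_cong) (auto simp: key)
  also have "map_pmf (\<lambda>(\<xi>, \<sigma>). (\<xi> \<circ> map_prod id t, \<sigma> \<circ> t)) (pair_pmf ?P (pmf_of_set ?S)) =
      pair_pmf (map_pmf (\<lambda>\<xi>. \<xi> \<circ> map_prod id t) ?P) (map_pmf (\<lambda>\<sigma>. \<sigma> \<circ> t) (pmf_of_set ?S))"
    by (simp add: map_pair)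
  finally show ?thesis unfolding P Q key_pmf_def[symmetric] t_def[symmetric] .
qed

text \<open>Rows from \<open>a\<close> on are compared with the artificial row \<open>Suc n\<close>,
  rows from \<open>b\<close> to \<open>a - 1\<close> with row \<open>a\<close>, and rows below
  \<open>b\<close> with row \<open>b\<close>. In each case \<open>gap_width\<close> bounds the
  distance to be covered.\<close>

lemma row_chain_eq_id:
  assumes \<sigma>: "\<sigma> permutes {1..n}" and b: "b \<in> {1..<a}" and a: "a \<in> {1..n}"
    and A: "row_key n k \<xi> \<sigma> \<in> argmax_at {1..n} a" and B: "row_key n k \<xi> \<sigma> \<in> argmax_at {1..<a} b"
    and count: "\<And>c. c \<in> {1..n} \<Longrightarrow> gap_width n a b \<le> card {j. j < k \<and> \<xi> (j, c)}"
  shows "row_chain n \<xi> k = (\<lambda>c. c)"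
proof
  fix c
  have first: "\<exists>i\<le>j. \<xi> (i, c)"
    if "row_key n k \<xi> \<sigma> c < row_key n k \<xi> \<sigma> d" "d \<in> {1..n}" "j < k" "\<xi> (j, d)" for d j
    using first_success_mono_imp[OF row_key_less_imp[OF that(1) \<sigma> that(2)] that(3,4)] .
  show "row_chain n \<xi> k c = c"
  proof (cases "c \<in> {1..n}")
    case c: True
    consider "a \<le> c" | "b \<le> c" "c < a" | "c < b" by linarith
    then show ?thesis
    proof cases
      case 1
      then show ?thesis
        using count[OF c] c by (intro row_chain_finished[of c n "Suc n"]) (auto simp: gap_width_def)
    next
      case 2
      then have "row_key n k \<xi> \<sigma> c < row_key n k \<xi> \<sigma> a"
        using A c by (auto simp: argmax_at_def)
      from first[OF this a] show ?thesis
        using count[OF c] c a 2 by (intro row_chain_finished[of c n a]) (auto simp: gap_width_def)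
    next
      case 3
      then have "row_key n k \<xi> \<sigma> c < row_key n k \<xi> \<sigma> b"
        using B c b by (auto simp: argmax_at_def)
      from first[OF this] show ?thesis
        using count[OF c] c a b 3 by (intro row_chain_finished[of c n b]) (auto simp: gap_width_def)
    qed
  qed (rule bracket_vectorsD(1)[OF row_chain_mem])
qed

lemma row_chain_eq_id_trivial:
  assumes count: "\<And>c. c \<in> {1..n} \<Longrightarrow> n \<le> card {j. j < k \<and> \<xi> (j, c)}"
  shows "row_chain n \<xi> k = (\<lambda>c. c)"
proof
  fix c show "row_chain n \<xi> k c = c"
  proof (cases "c \<in> {1..n}")
    case True
    then show ?thesis
      using count[OF True] by (intro row_chain_finished[of c n "Suc n"]) auto
  qed (rule bracket_vectorsD(1)[OF row_chain_mem])
qed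

text \<open>The number of successes of one row is binomial, so this is Hoeffding's inequality for
  its lower tail.\<close>

lemma prob_row_count_le:
  fixes c n :: nat
  assumes p: "0 \<le> p" "p \<le> 1" and c: "c \<in> {1..n}" and \<epsilon>: "\<epsilon> \<ge> 0"
  shows "measure_pmf.prob (coin_field p ({..<k} \<times> {1..n}))
      {\<xi>. real (card {j. j < k \<and> \<xi> (j, c)}) \<le> real k * p - real k * \<epsilon>} \<le> exp (- 2 * \<epsilon>\<^sup>2 * real k)"
proof (cases "k = 0")
  case False
  let ?P = "coin_field p ({..<k} \<times> {1..n})"
  have "card {x \<in> {..<k} \<times> {c}. \<xi> x} = card {j. j < k \<and> \<xi> (j, c)}" for \<xi>
    by (rule bij_betw_same_card[of fst]) (auto simp: bij_betw_def inj_on_def image_iff)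
  then have "binomial_pmf k p = map_pmf (\<lambda>\<xi>. card {j. j < k \<and> \<xi> (j, c)}) (coin_field p ({..<k} \<times> {c}))"
    using binomial_pmf_altdef'[of "{..<k} \<times> {c}" k p False] p by simp
  also have "coin_field p ({..<k} \<times> {c}) =
      map_pmf (\<lambda>f x. if x \<in> {..<k} \<times> {c} then f x else False) ?P"
    by (rule Pi_pmf_subset) (use c in auto)
  also have "map_pmf (\<lambda>\<xi>. card {j. j < k \<and> \<xi> (j, c)}) \<dots> = map_pmf (\<lambda>\<xi>. card {j. j < k \<and> \<xi> (j, c)}) ?P"
    unfolding map_pmf_comp by (intro map_pmf_cong refl arg_cong[of _ _ card]) auto
  finally have bin: "binomial_pmf k p = map_pmf (\<lambda>\<xi>. card {j. j < k \<and> \<xi> (j, c)}) ?P" .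
  have "measure_pmf.prob ?P {\<xi>. real (card {j. j < k \<and> \<xi> (j, c)}) \<le> real k * p - real k * \<epsilon>} =
      measure_pmf.prob (binomial_pmf k p) {x. real x \<le> real k * p - real k * \<epsilon>}"
    unfolding bin by (simp add: vimage_def)
  also have "\<dots> \<le> exp (- 2 * (real k * \<epsilon>)\<^sup>2 / real k)"
    by (rule binomial_distribution.prob_le) (use p \<epsilon> False in \<open>auto simp: binomial_distribution_def\<close>)
  also have "- 2 * (real k * \<epsilon>)\<^sup>2 / real k = - 2 * \<epsilon>\<^sup>2 * real k"
    using False by (simp add: power2_eq_square)
  finally show ?thesis .
qed simp

text \<open>An unfinished chain has a row with at most \<open>k * (p - \<epsilon>)\<close>
  successes, or its two latest rows have a width above that number. If row 1 is the latest, the pair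
  does not exist and \<open>n\<close> takes the role of the width.\<close>

lemma prob_row_chain_le:
  assumes p: "0 \<le> p" "p \<le> 1" and \<epsilon>: "\<epsilon> \<ge> 0" and n: "n \<ge> 1"
  shows "measure_pmf.prob (coin_field p ({..<k} \<times> {1..n})) {\<xi>. row_chain n \<xi> k \<noteq> (\<lambda>a. a)} \<le>
    (\<Sum>a=2..n. \<Sum>b=1..<a. of_bool (real k * (p - \<epsilon>) < real (gap_width n a b)) / (real n * (real a - 1)))
    + of_bool (real k * (p - \<epsilon>) < real n) / real n + sqrt (real n) * exp (- \<epsilon>\<^sup>2 * real k)"
proof -
  let ?P = "coin_field p ({..<k} \<times> {1..n})"
  let ?S = "pmf_of_set {\<sigma>. \<sigma> permutes {1..n}}"
  let ?PS = "pair_pmf ?P ?S"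
  define t where "t = real k * (p - \<epsilon>)"
  define K where "K = (\<lambda>(\<xi>, \<sigma>). row_key n k \<xi> \<sigma>)"
  define E where "E a b = (if t < real (gap_width n a b)
    then K -` (argmax_at {1..n} a \<inter> argmax_at {1..<a} b) else {})" for a b
  define F where "F = (if t < real n then K -` argmax_at {1..n} 1 else {})"
  define G where "G = {\<xi>. \<exists>c\<in>{1..n}. real (card {j. j < k \<and> \<xi> (j, c)}) \<le> t}"
  define B where "B = {\<xi>. row_chain n \<xi> k \<noteq> (\<lambda>a. a)}"
  have pK: "measure_pmf.prob ?PS (K -` X) = measure_pmf.prob (key_pmf p n k) X" for X
    unfolding key_pmf_def K_def by simp
  have pE: "measure_pmf.prob ?PS (E a b) = of_bool (t < real (gap_width n a b)) / (real n * (real a - 1))"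
    if "a \<in> {1..n}" "b \<in> {1..<a}" for a b
  proof -
    have "measure_pmf.prob (key_pmf p n k) (argmax_at {1..n} a \<inter> argmax_at {1..<a} b) =
        1 / (real n * (real a - 1))"
      using inj_on_key_pmf key_pmf_exchangeable that by (rule prob_two_argmax_at)
    then show ?thesis
      using pK[of "argmax_at {1..n} a \<inter> argmax_at {1..<a} b"]
      unfolding E_def by (cases "t < real (gap_width n a b)") (simp_all del: vimage_Int)
  qed
  have pF: "measure_pmf.prob ?PS F = of_bool (t < real n) / real n"
  proof -
    have "measure_pmf.prob (key_pmf p n k) (argmax_at {1..n} 1) = 1 / real n"
      using inj_on_key_pmf key_pmf_exchangeable by (rule prob_argmax_at) (use n in auto)
    then show ?thesis
      using pK[of "argmax_at {1..n} 1"] unfolding F_def by (cases "t < real n") simp_all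
  qed
  have pG: "measure_pmf.prob ?P G \<le> sqrt (real n) * exp (- \<epsilon>\<^sup>2 * real k)"
  proof -
    have "G = (\<Union>c\<in>{1..n}. {\<xi>. real (card {j. j < k \<and> \<xi> (j, c)}) \<le> t})"
      by (auto simp: G_def)
    then have "measure_pmf.prob ?P G \<le>
        (\<Sum>c=1..n. measure_pmf.prob ?P {\<xi>. real (card {j. j < k \<and> \<xi> (j, c)}) \<le> t})"
      by (simp only:) (rule measure_pmf.finite_measure_subadditive_finite; simp)
    also have "\<dots> \<le> (\<Sum>c=1..n. exp (- 2 * \<epsilon>\<^sup>2 * real k))"
      by (rule sum_mono) (use prob_row_count_le[OF p _ \<epsilon>] in \<open>simp add: t_def right_diff_distrib\<close>)
    also have "\<dots> = (sqrt (real n) * exp (- \<epsilon>\<^sup>2 * real k))\<^sup>2"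
      by (simp add: power_mult_distrib exp_double[symmetric] algebra_simps)
    finally have le: "measure_pmf.prob ?P G \<le> (sqrt (real n) * exp (- \<epsilon>\<^sup>2 * real k))\<^sup>2" .
    \<comment> \<open>The union bound gives \<open>y * y\<close>, and a probability is at most 1;
      the smaller of the two is at most \<open>y\<close>. Passing to \<open>y\<close> replaces the
      factor \<open>n\<close> by \<open>sqrt n\<close>, so that the sum over all \<open>k\<close>
      remains of order \<open>sqrt n\<close>.\<close>
    define y where "y = sqrt (real n) * exp (- \<epsilon>\<^sup>2 * real k)"
    have "y \<ge> 0" by (simp add: y_def)
    show ?thesis
    proof (cases "y \<le> 1")
      case True
      then have "y\<^sup>2 \<le> y" using \<open>y \<ge> 0\<close> by (simp add: power2_eq_square mult_left_le)
      with le show ?thesis by (simp add: y_def)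
    next
      case False
      then show ?thesis
        unfolding y_def[symmetric] by (intro order_trans[OF measure_pmf.prob_le_1]) simp
    qed
  qed
  have "measure_pmf.prob ?P B = measure_pmf.prob (map_pmf fst ?PS) B"
    by (simp add: map_fst_pair_pmf)
  also have "\<dots> = measure_pmf.prob ?PS (fst -` B)" by simp
  also have "\<dots> \<le> measure_pmf.prob ?PS ((\<Union>a\<in>{2..n}. \<Union>b\<in>{1..<a}. E a b) \<union> F \<union> fst -` G)"
  proof (rule measure_pmf.finite_measure_mono_AE)
    have "z \<in> (\<Union>a\<in>{2..n}. \<Union>b\<in>{1..<a}. E a b) \<union> F \<union> fst -` G"
      if z: "z \<in> set_pmf ?PS" "z \<in> fst -` B" for z
    proof (rule ccontr)
      assume not: "z \<notin> (\<Union>a\<in>{2..n}. \<Union>b\<in>{1..<a}. E a b) \<union> F \<union> fst -` G"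
      obtain \<xi> \<sigma> where [simp]: "z = (\<xi>, \<sigma>)" by force
      have "\<sigma> \<in> set_pmf ?S" using z(1) by simp
      then have \<sigma>: "\<sigma> permutes {1..n}" unfolding set_pmf_of_set_permutes by (rule CollectD)
      have inj: "inj_on (row_key n k \<xi> \<sigma>) S" if "S \<subseteq> {1..n}" for S
        using inj_on_subset[OF inj_on_row_key[OF \<sigma>] that] .
      have ex: "\<exists>a\<in>S. row_key n k \<xi> \<sigma> \<in> argmax_at S a" if "S \<subseteq> {1..n}" "S \<noteq> {}" for S
        using that inj[OF that(1)] finite_subset[OF that(1)] by (intro ex_argmax_at) simp_all
      have cnt: "t < real (card {j. j < k \<and> \<xi> (j, c)})" if "c \<in> {1..n}" for c
        using not that by (auto simp: G_def not_le)
      obtain a where a: "a \<in> {1..n}" "row_key n k \<xi> \<sigma> \<in> argmax_at {1..n} a"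
        using ex[of "{1..n}"] n by auto
      have "row_chain n \<xi> k = (\<lambda>c. c)"
      proof (cases "a = 1")
        case True
        have "real n \<le> t" using not a True by (auto simp: F_def K_def split: if_splits)
        then have "n \<le> card {j. j < k \<and> \<xi> (j, c)}" if "c \<in> {1..n}" for c
          using cnt[OF that] by linarith
        then show ?thesis by (rule row_chain_eq_id_trivial)
      next
        case False
        then obtain b where b: "b \<in> {1..<a}" "row_key n k \<xi> \<sigma> \<in> argmax_at {1..<a} b"
          using ex[of "{1..<a}"] a by force
        have "z \<notin> E a b" using not False a(1) b(1) by force
        then have "real (gap_width n a b) \<le> t"
          using a(2) b(2) by (auto simp: E_def K_def split: if_splits)
        then have "gap_width n a b \<le> card {j. j < k \<and> \<xi> (j, c)}" if "c \<in> {1..n}" for c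
          using cnt[OF that] by linarith
        then show ?thesis using row_chain_eq_id[OF \<sigma> b(1) a(1,2) b(2)] by blast
      qed
      with z(2) show False by (simp add: B_def)
    qed
    then show "AE z in measure_pmf ?PS. z \<in> fst -` B \<longrightarrow>
        z \<in> (\<Union>a\<in>{2..n}. \<Union>b\<in>{1..<a}. E a b) \<union> F \<union> fst -` G"
      by (simp add: AE_measure_pmf_iff)
  qed simp
  also have "\<dots> \<le> measure_pmf.prob ?PS (\<Union>a\<in>{2..n}. \<Union>b\<in>{1..<a}. E a b) +
      measure_pmf.prob ?PS F + measure_pmf.prob ?PS (fst -` G)"
    by (intro order_trans[OF measure_Un_le] add_mono order_refl) auto
  also have "measure_pmf.prob ?PS (fst -` G) = measure_pmf.prob (map_pmf fst ?PS) G" by simp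
  also have "\<dots> = measure_pmf.prob ?P G" by (simp add: map_fst_pair_pmf)
  also have "measure_pmf.prob ?PS (\<Union>a\<in>{2..n}. \<Union>b\<in>{1..<a}. E a b) \<le>
      (\<Sum>a=2..n. measure_pmf.prob ?PS (\<Union>b\<in>{1..<a}. E a b))"
    by (rule measure_pmf.finite_measure_subadditive_finite) auto
  also have "\<dots> \<le> (\<Sum>a=2..n. \<Sum>b=1..<a. measure_pmf.prob ?PS (E a b))"
    by (intro sum_mono measure_pmf.finite_measure_subadditive_finite) auto
  also have "\<dots> = (\<Sum>a=2..n. \<Sum>b=1..<a. of_bool (t < real (gap_width n a b)) / (real n * (real a - 1)))"
    by (intro sum.cong refl pE) auto
  finally show ?thesis
    using pF pG unfolding t_def B_def by simp
qed

section \<open>The expected number of steps\<close>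

lemma sum_of_bool_less_le:
  fixes r w :: real
  assumes "0 < r" "0 \<le> w"
  shows "(\<Sum>k<N. of_bool (real k * r < w)) \<le> w / r + 1"
proof -
  have "(\<Sum>k<N. of_bool (real k * r < w) :: real) = real (card ({..<N} \<inter> {k. real k * r < w}))"
    by simp
  also have "\<dots> \<le> real (card {..<nat \<lceil>w / r\<rceil>})"
  proof (intro of_nat_mono card_mono subsetI)
    fix k assume "k \<in> {..<N} \<inter> {k. real k * r < w}"
    then have "real k < w / r" using assms by (simp add: field_simps)
    then show "k \<in> {..<nat \<lceil>w / r\<rceil>}" by simp linarith
  qed simp
  also have "\<dots> \<le> w / r + 1"
  proof -
    have "0 \<le> w / r" using assms by simp
    then show ?thesis by simp
  qed
  finally show ?thesis .
qed

lemma sum_exp_neg_le: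
  assumes "0 < (c :: real)"
  shows "(\<Sum>k<N. exp (- c * real k)) \<le> 1 / (1 - exp (- c))"
proof -
  have q: "norm (exp (- c)) < 1" using assms by simp
  have "(\<Sum>k<N. exp (- c * real k)) = (\<Sum>k<N. exp (- c) ^ k)"
    by (intro sum.cong refl) (simp add: exp_of_nat_mult[symmetric] mult.commute)
  also have "\<dots> \<le> (\<Sum>k. exp (- c) ^ k)"
    by (rule sum_le_suminf) (use q in \<open>auto intro: summable_geometric\<close>)
  also have "\<dots> = 1 / (1 - exp (- c))" by (rule suminf_geometric[OF q])
  finally show ?thesis .
qed

text \<open>Here \<open>r\<close> is \<open>p - \<epsilon>\<close>. Summing over the time first
  turns each width \<open>w\<close> into \<open>w / r + 1\<close>, and averaging over the pairs then
  gives the mean width divided by \<open>r\<close>.\<close>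

lemma sum_prob_row_chain_le:
  assumes r: "0 < r" "r < p" and p: "p \<le> 1" and n: "n \<ge> 1"
  shows "(\<Sum>k<N. measure_pmf.prob (coin_field p ({..<k} \<times> {1..n})) {\<xi>. row_chain n \<xi> k \<noteq> (\<lambda>a. a)}) \<le>
    2 / (3 * r) * real n + (9 / (4 * r) + 2 + sqrt (real n) * (1 / (1 - exp (- (p - r)\<^sup>2))))"
proof -
  let ?w = "\<lambda>a b. real (gap_width n a b)"
  let ?d = "\<lambda>a. real n * (real a - 1)"
  have "(\<Sum>k<N. measure_pmf.prob (coin_field p ({..<k} \<times> {1..n})) {\<xi>. row_chain n \<xi> k \<noteq> (\<lambda>a. a)}) \<le>
    (\<Sum>k<N. (\<Sum>a=2..n. \<Sum>b=1..<a. of_bool (real k * r < ?w a b) / ?d a)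
      + of_bool (real k * r < real n) / real n + sqrt (real n) * exp (- (p - r)\<^sup>2 * real k))"
    by (rule sum_mono) (use prob_row_chain_le[of p "p - r" n] r p n in simp)
  also have "\<dots> = (\<Sum>k<N. \<Sum>a=2..n. \<Sum>b=1..<a. of_bool (real k * r < ?w a b) / ?d a)
      + (\<Sum>k<N. of_bool (real k * r < real n)) / real n
      + sqrt (real n) * (\<Sum>k<N. exp (- (p - r)\<^sup>2 * real k))"
    by (simp only: sum.distrib sum_divide_distrib sum_distrib_left)
  also have "(\<Sum>k<N. \<Sum>a=2..n. \<Sum>b=1..<a. of_bool (real k * r < ?w a b) / ?d a) =
      (\<Sum>a=2..n. \<Sum>b=1..<a. (\<Sum>k<N. of_bool (real k * r < ?w a b)) / ?d a)"
    unfolding sum_divide_distrib by (subst sum.swap, rule sum.cong[OF refl], rule sum.swap)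
  also have "(\<Sum>a=2..n. \<Sum>b=1..<a. (\<Sum>k<N. of_bool (real k * r < ?w a b)) / ?d a) \<le>
      (\<Sum>a=2..n. \<Sum>b=1..<a. (?w a b / r + 1) / ?d a)"
    by (intro sum_mono divide_right_mono sum_of_bool_less_le r) auto
  also have "\<dots> = (\<Sum>a=2..n. \<Sum>b=1..<a. (?w a b + r) / ?d a) / r"
    unfolding sum_divide_distrib using r by (intro sum.cong refl) (simp add: field_simps)
  also have "\<dots> \<le> (2 / 3 * real n + 5 / 4 + \<bar>r\<bar>) / r"
    by (intro divide_right_mono sum_gap_width_le n) (use r in simp)
  finally have "(\<Sum>k<N. measure_pmf.prob (coin_field p ({..<k} \<times> {1..n})) {\<xi>. row_chain n \<xi> k \<noteq> (\<lambda>a. a)}) \<le>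
    (2 / 3 * real n + 5 / 4 + \<bar>r\<bar>) / r + (\<Sum>k<N. of_bool (real k * r < real n)) / real n
      + sqrt (real n) * (\<Sum>k<N. exp (- (p - r)\<^sup>2 * real k))"
    by simp
  moreover have "(\<Sum>k<N. of_bool (real k * r < real n)) / real n \<le> 1 / r + 1"
  proof -
    have "(\<Sum>k<N. of_bool (real k * r < real n)) / real n \<le> (real n / r + 1) / real n"
      by (intro divide_right_mono sum_of_bool_less_le r) auto
    also have "\<dots> \<le> 1 / r + 1"
      using n r by (simp add: field_simps)
    finally show ?thesis .
  qed
  moreover have "sqrt (real n) * (\<Sum>k<N. exp (- (p - r)\<^sup>2 * real k)) \<le>
      sqrt (real n) * (1 / (1 - exp (- (p - r)\<^sup>2)))"
    by (intro mult_left_mono sum_exp_neg_le) (use r in auto)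
  moreover have "(2 / 3 * real n + 5 / 4 + \<bar>r\<bar>) / r + (1 / r + 1) = 2 / (3 * r) * real n + (9 / (4 * r) + 2)"
    using r by (simp add: field_simps)
  ultimately show ?thesis by linarith
qed

lemma ungarian_expectation_Tam_bound:
  assumes r: "0 < r" "r < p" and p: "p \<le> 1"
  shows "\<exists>C\<ge>0. \<forall>n. ungarian_expectation p (Tam n) \<le>
    ennreal (2 / (3 * r) * real n + C * (1 + sqrt (real n)))"
proof -
  define C where "C = 9 / (4 * r) + 2 + 1 / (1 - exp (- (p - r)\<^sup>2))"
  have C1: "1 / (1 - exp (- (p - r)\<^sup>2)) \<ge> 0" using r by simp
  then have C: "C \<ge> 9 / (4 * r) + 2" "C \<ge> 1 / (1 - exp (- (p - r)\<^sup>2))" "C \<ge> 0"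
    using r by (auto simp: C_def)
  have "ungarian_expectation p (Tam n) \<le> ennreal (2 / (3 * r) * real n + C * (1 + sqrt (real n)))" for n
  proof -
    let ?P = "\<lambda>k. measure_pmf.prob (coin_field p ({..<k} \<times> {1..n})) {\<xi>. row_chain n \<xi> k \<noteq> (\<lambda>a. a)}"
    have "(\<Sum>k<N. ?P k) \<le> 2 / (3 * r) * real n + C * (1 + sqrt (real n))" for N
    proof (cases "n = 0")
      case True
      have "row_chain 0 \<xi> k = (\<lambda>a. a)" for \<xi> k
        by (rule ext, rule bracket_vectorsD(1)[OF row_chain_mem]) simp
      then show ?thesis using True C by simp
    next
      case False
      then have "(\<Sum>k<N. ?P k) \<le>
          2 / (3 * r) * real n + (9 / (4 * r) + 2 + sqrt (real n) * (1 / (1 - exp (- (p - r)\<^sup>2))))"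
        by (intro sum_prob_row_chain_le r p) simp
      also have "\<dots> \<le> 2 / (3 * r) * real n + (C + sqrt (real n) * C)"
        using C by (intro add_left_mono add_mono mult_left_mono) auto
      finally show ?thesis by (simp add: algebra_simps)
    qed
    then have "(\<Sum>k<N. ennreal (?P k)) \<le> ennreal (2 / (3 * r) * real n + C * (1 + sqrt (real n)))" for N
      by (simp add: sum_ennreal ennreal_leI)
    then have "(\<Sum>k. ennreal (?P k)) \<le> ennreal (2 / (3 * r) * real n + C * (1 + sqrt (real n)))"
      by (intro suminf_le_const summableI)
    then show ?thesis using ungarian_expectation_Tam_le[of p n] by (rule order_trans[rotated])
  qed
  with C(3) show ?thesis by blast
qed

text \<open>All rows succeed at time 0. Comparing row \<open>c\<close> with row \<open>Suc c\<close>
  shows that one success finishes it, so only the term \<open>k = 0\<close> can be positive.\<close>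

lemma ungarian_expectation_Tam_1: "ungarian_expectation 1 (Tam n) \<le> 1"
proof -
  let ?P = "\<lambda>k. measure_pmf.prob (coin_field 1 ({..<k} \<times> {1..n})) {\<xi>. row_chain n \<xi> k \<noteq> (\<lambda>a. a)}"
  have zero: "?P k = 0" if "k \<noteq> 0" for k
  proof -
    let ?\<xi> = "\<lambda>x. x \<in> {..<k} \<times> {1..n}"
    have "row_chain n ?\<xi> k = (\<lambda>a. a)"
    proof
      fix c show "row_chain n ?\<xi> k c = c"
      proof (cases "c \<in> {1..n}")
        case True
        then have "{j. j < k \<and> (j, c) \<in> {..<k} \<times> {1..n}} = {..<k}" by auto
        then show ?thesis
          using True that by (intro row_chain_finished[of c n "Suc c"]) auto
      qed (rule bracket_vectorsD(1)[OF row_chain_mem])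
    qed
    moreover have "coin_field 1 ({..<k} \<times> {1..n}) = return_pmf ?\<xi>"
    proof -
      have "bernoulli_pmf 1 = return_pmf True"
      proof (rule pmf_eqI)
        fix b show "pmf (bernoulli_pmf 1) b = pmf (return_pmf True) b" by (cases b) simp_all
      qed
      then show ?thesis by (simp add: Pi_pmf_return_pmf)
    qed
    ultimately show ?thesis by simp
  qed
  have "(\<Sum>k<N. ennreal (?P k)) \<le> 1" for N
  proof -
    have "(\<Sum>k<N. ennreal (?P k)) \<le> (\<Sum>k<N. if k = 0 then 1 else 0)"
      by (rule sum_mono) (use zero in auto)
    also have "\<dots> \<le> 1" by simp
    finally show ?thesis .
  qed
  then have "(\<Sum>k. ennreal (?P k)) \<le> 1" by (intro suminf_le_const summableI)
  then show ?thesis using ungarian_expectation_Tam_le[of 1 n] by (rule order_trans[rotated])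
qed

section \<open>The function Upsilon\<close>

lemma summable_on_int_powi_abs:
  fixes q :: real
  assumes "0 \<le> q" "q < 1"
  shows "(\<lambda>k::int. q ^ nat \<bar>k\<bar>) summable_on UNIV"
proof -
  have g: "(\<lambda>n::nat. q ^ n) summable_on UNIV"
    using assms by (intro norm_summable_imp_summable_on) (simp add: summable_geometric)
  have "(\<lambda>k::int. q ^ nat \<bar>k\<bar>) summable_on (int ` UNIV)"
    by (subst summable_on_reindex) (use g in \<open>auto simp: o_def inj_on_def\<close>)
  moreover have "(\<lambda>k::int. q ^ nat \<bar>k\<bar>) summable_on ((\<lambda>n. - int n) ` UNIV)"
    by (subst summable_on_reindex) (use g in \<open>auto simp: o_def inj_on_def\<close>)
  ultimately have "(\<lambda>k::int. q ^ nat \<bar>k\<bar>) summable_on (int ` UNIV \<union> (\<lambda>n. - int n) ` UNIV)"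
    by (rule summable_on_union)
  moreover have "int ` UNIV \<union> (\<lambda>n. - int n) ` UNIV = UNIV"
    by (metis (no_types, lifting) UNIV_eq_I UnCI int_cases2 rangeI)
  ultimately show ?thesis by simp
qed

text \<open>A summable majorant, uniform in \<open>x \<ge> d\<close>. For \<open>k \<ge> 0\<close>
  the exponential is at most 1; for negative \<open>k\<close> the power is large, and
  \<open>exp y\<close> is at least half the square of \<open>y\<close>.\<close>

lemma powi_mult_exp_le:
  fixes q x d :: real
  assumes q: "0 < q" "q < 1" and d: "0 < d" "d \<le> x"
  shows "\<bar>q powi k * exp (- (q powi k * x))\<bar> \<le> (1 + 2 / d\<^sup>2) * q ^ nat \<bar>k\<bar>"
proof -
  define u where "u = q powi k"
  have u: "u > 0" unfolding u_def using q by simp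
  have "u * exp (- (u * x)) \<le> (1 + 2 / d\<^sup>2) * q ^ nat \<bar>k\<bar>"
  proof (cases "k \<ge> 0")
    case True
    then have uq: "u = q ^ nat \<bar>k\<bar>" by (simp add: u_def power_int_def)
    have "u * exp (- (u * x)) \<le> u * 1"
      using u d by (intro mult_left_mono) auto
    also have "\<dots> \<le> (1 + 2 / d\<^sup>2) * u"
      using u by (simp add: field_simps)
    finally show ?thesis unfolding uq .
  next
    case False
    then have uq: "inverse u = q ^ nat \<bar>k\<bar>"
      by (simp add: u_def power_int_def power_inverse)
    have "(u * d)\<^sup>2 / 2 \<le> exp (u * d)"
    proof -
      have "0 \<le> u * d" using u d by simp
      then show ?thesis using exp_lower_Taylor_quadratic[of "u * d"] by linarith
    qed
    also have "\<dots> \<le> exp (u * x)" using u d by simp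
    finally have "exp (- (u * x)) \<le> inverse ((u * d)\<^sup>2 / 2)"
      unfolding exp_minus using u d by (intro le_imp_inverse_le) auto
    then have "u * exp (- (u * x)) \<le> u * inverse ((u * d)\<^sup>2 / 2)"
      using u by (intro mult_left_mono) auto
    also have "\<dots> = 2 / d\<^sup>2 * inverse u"
      using u d by (simp add: field_simps power2_eq_square)
    also have "\<dots> \<le> (1 + 2 / d\<^sup>2) * inverse u"
      using u by (intro mult_right_mono) auto
    finally show ?thesis unfolding uq .
  qed
  then show ?thesis unfolding u_def using q by simp
qed

lemma Upsilon_summable:
  fixes q x :: real
  assumes "0 < q" "q < 1" "0 < x"
  shows "(\<lambda>k::int. q powi k * exp (- (q powi k * x))) summable_on UNIV"
proof (rule summable_on_comparison_test)
  show "(\<lambda>k::int. (1 + 2 / x\<^sup>2) * q ^ nat \<bar>k\<bar>) summable_on UNIV"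
    using assms by (intro summable_on_cmult_right summable_on_int_powi_abs) auto
  fix k :: int
  show "q powi k * exp (- (q powi k * x)) \<le> (1 + 2 / x\<^sup>2) * q ^ nat \<bar>k\<bar>"
    using powi_mult_exp_le[of q x x k] assms by simp
qed (use assms in simp)

text \<open>The Weierstrass test. The majorant blows up as \<open>d\<close> tends to 0, so the
  statement concerns a half-line away from 0.\<close>

lemma continuous_on_Upsilon:
  assumes p: "0 < p" "p < 1" and d: "0 < d"
  shows "continuous_on {d..} (Upsilon p)"
proof -
  let ?f = "\<lambda>k x. (1 - p) powi k * exp (- ((1 - p) powi k * x))"
  have "uniform_limit {d..} (\<lambda>X x. \<Sum>k\<in>X. ?f k x) (\<lambda>x. \<Sum>\<^sub>\<infinity>k\<in>(UNIV :: int set). ?f k x)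
      (finite_subsets_at_top UNIV)"
  proof (rule Weierstrass_m_test_general)
    show "(\<lambda>k::int. (1 + 2 / d\<^sup>2) * (1 - p) ^ nat \<bar>k\<bar>) summable_on UNIV"
      using p by (intro summable_on_cmult_right summable_on_int_powi_abs) auto
    show "norm (?f k x) \<le> (1 + 2 / d\<^sup>2) * (1 - p) ^ nat \<bar>k\<bar>" if "x \<in> {d..}" for k x
      using powi_mult_exp_le[of "1 - p" d x k] p d that by simp
  qed
  then have "continuous_on {d..} (\<lambda>x. \<Sum>\<^sub>\<infinity>k\<in>(UNIV :: int set). ?f k x)"
    by (rule uniform_limit_theorem[rotated]) (auto intro!: always_eventually continuous_intros)
  then have "continuous_on {d..} (\<lambda>x. p * x * (\<Sum>\<^sub>\<infinity>k\<in>(UNIV :: int set). ?f k x))"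
    by (intro continuous_intros)
  then show ?thesis using p by (simp add: Upsilon_def[abs_def])
qed

text \<open>The factor \<open>1 - p\<close> is absorbed by shifting the summation index by
  1.\<close>

lemma Upsilon_scale:
  assumes p: "0 < p" "p < 1"
  shows "Upsilon p ((1 - p) * x) = Upsilon p x"
proof -
  define q where "q = 1 - p"
  have q: "q > 0" using p by (simp add: q_def)
  let ?f = "\<lambda>k::int. q powi k * exp (- (q powi k * x))"
  have "Upsilon p (q * x) = p * x * (q * (\<Sum>\<^sub>\<infinity>k. q powi k * exp (- (q powi k * (q * x)))))"
    using p by (simp add: Upsilon_def q_def)
  also have "q * (\<Sum>\<^sub>\<infinity>k. q powi k * exp (- (q powi k * (q * x)))) = (\<Sum>\<^sub>\<infinity>k. ?f (k + 1))"
    unfolding infsum_cmult_right'[symmetric] using q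
    by (intro infsum_cong) (simp add: power_int_add mult_ac)
  also have "\<dots> = (\<Sum>\<^sub>\<infinity>k. ?f k)"
    by (rule infsum_reindex_bij_witness[of _ "\<lambda>k. k - 1" "\<lambda>k. k + 1"]) auto
  also have "p * x * \<dots> = Upsilon p x"
    using p by (simp add: Upsilon_def q_def)
  finally show ?thesis by (simp add: q_def)
qed

lemma Upsilon_scale_iterate:
  assumes p: "0 < p" "p < 1"
  shows "Upsilon p ((1 - p) ^ m * x) = Upsilon p x"
proof (induction m)
  case (Suc m)
  then show ?case using Upsilon_scale[OF p, of "(1 - p) ^ m * x"] by (simp add: mult.assoc)
qed simp

text \<open>By scale invariance, every value on the open unit interval is attained on the compact
  period from \<open>q * q\<close> to \<open>q\<close>. Continuity gives a maximum there, so
  \<open>GREATEST\<close> denotes a genuine maximum. The period from \<open>q\<close> to 1 is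
  avoided because it contains 1.\<close>

lemma rho_bar_ge_Upsilon:
  assumes p: "0 < p" "p < 1" and x: "0 < x" "x < 1"
  shows "Upsilon p x \<le> rho_bar p"
proof -
  define q where "q = 1 - p"
  have q: "0 < q" "q < 1" using p by (auto simp: q_def)
  have "\<exists>y\<in>{q\<^sup>2..q}. \<forall>z\<in>{q\<^sup>2..q}. Upsilon p z \<le> Upsilon p y"
  proof (rule continuous_attains_sup)
    show "compact {q\<^sup>2..q}" by simp
    show "{q\<^sup>2..q} \<noteq> {}" using q by (simp add: power2_eq_square)
    show "continuous_on {q\<^sup>2..q} (Upsilon p)"
      by (rule continuous_on_subset[OF continuous_on_Upsilon[OF p, of "q\<^sup>2"]]) (use q in auto)
  qed
  then obtain y where y: "y \<in> {q\<^sup>2..q}" "\<And>z. z \<in> {q\<^sup>2..q} \<Longrightarrow> Upsilon p z \<le> Upsilon p y"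
    by blast
  have y01: "0 < y" "y < 1"
    using y(1) q by (auto intro: less_le_trans[of _ "q\<^sup>2"])
  have max: "Upsilon p z \<le> Upsilon p y" if z: "0 < z" "z < 1" for z
  proof -
    \<comment> \<open>With \<open>m = Suc l\<close>, the quotient \<open>z / q ^ l\<close> lies
      between \<open>q\<close> and 1. One more factor \<open>q\<close> moves it into the chosen
      period.\<close>
    define m where "m = (LEAST m. q ^ m \<le> z)"
    obtain m0 where "q ^ m0 < z" using real_arch_pow_inv[of z q] z q by blast
    then have m: "q ^ m \<le> z"
      unfolding m_def by (rule LeastI[of "\<lambda>m. q ^ m \<le> z", OF less_imp_le])
    have "m \<noteq> 0" using m z by (intro notI) simp
    then obtain l where l: "m = Suc l" using not0_implies_Suc by blast
    have "z < q ^ l"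
      using not_less_Least[of l "\<lambda>m. q ^ m \<le> z"] l unfolding m_def by auto
    have ql: "q ^ l > 0" using q by simp
    define w where "w = z / q ^ l * q"
    have "w \<in> {q\<^sup>2..q}"
    proof -
      have "q \<le> z / q ^ l" "z / q ^ l \<le> 1"
        using m \<open>z < q ^ l\<close> ql by (simp_all add: l field_simps)
      then have "q * q \<le> z / q ^ l * q" "z / q ^ l * q \<le> 1 * q"
        using q by (intro mult_right_mono; simp)+
      then show ?thesis unfolding w_def by (simp add: power2_eq_square)
    qed
    moreover have "Upsilon p w = Upsilon p z"
    proof -
      have "Upsilon p w = Upsilon p (q * (z / q ^ l))" by (simp add: w_def mult.commute)
      also have "\<dots> = Upsilon p (z / q ^ l)" unfolding q_def by (rule Upsilon_scale[OF p])
      also have "\<dots> = Upsilon p (q ^ l * (z / q ^ l))"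
        unfolding q_def by (rule Upsilon_scale_iterate[OF p, symmetric])
      finally show ?thesis using q by simp
    qed
    ultimately show ?thesis using y(2)[of w] by simp
  qed
  have "rho_bar p = Upsilon p y"
    unfolding rho_bar_def
    by (rule Greatest_equality) (use y01 max in auto)
  then show ?thesis using max[OF x] by simp
qed

text \<open>Keeping the terms with \<open>k \<ge> 0\<close> at \<open>x = 1\<close>, each is at least \<open>(1 - p)\<^sup>k / e\<close>.\<close>

lemma Upsilon_one_ge:
  assumes p: "0 < p" "p < 1"
  shows "exp (- 1) \<le> Upsilon p 1"
proof -
  define q where "q = 1 - p"
  have q: "0 < q" "q < 1" using p by (auto simp: q_def)
  let ?f = "\<lambda>k::int. q powi k * exp (- (q powi k * 1))"
  have sum: "?f summable_on UNIV" by (rule Upsilon_summable) (use q in auto)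
  have "(\<lambda>n::nat. q ^ n * exp (- 1)) sums (1 / (1 - q) * exp (- 1))"
    using q by (intro sums_mult2 geometric_sums) simp
  then have "((\<lambda>n::nat. q ^ n * exp (- 1)) has_sum (1 / (1 - q) * exp (- 1))) UNIV"
    using q by (intro norm_summable_imp_has_sum) (auto simp: summable_mult2 summable_geometric)
  then have "1 / (1 - q) * exp (- 1) = (\<Sum>\<^sub>\<infinity>n::nat. q ^ n * exp (- 1))"
    by (rule infsumI[symmetric])
  also have "\<dots> \<le> (\<Sum>\<^sub>\<infinity>n::nat. ?f (int n))"
  proof (rule infsum_mono)
    show "(\<lambda>n::nat. q ^ n * exp (- 1)) summable_on UNIV"
      using \<open>((\<lambda>n::nat. q ^ n * exp (- 1)) has_sum _) UNIV\<close> by (auto simp: summable_on_def)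
    show "(\<lambda>n::nat. ?f (int n)) summable_on UNIV"
      using summable_on_reindex[of int UNIV ?f] summable_on_subset[OF sum, of "range int"]
      by (simp add: o_def)
    fix n :: nat
    have "q ^ n \<le> 1" using q by (simp add: power_le_one)
    then show "q ^ n * exp (- 1) \<le> ?f (int n)"
      using q by (auto intro!: mult_left_mono)
  qed
  also have "\<dots> = infsum ?f (range int)"
    by (subst infsum_reindex) (auto simp: o_def inj_on_def)
  also have "\<dots> \<le> infsum ?f UNIV"
    using q by (intro infsum_mono_neutral summable_on_subset[OF sum] sum) auto
  finally have "p * (1 / p * exp (- 1)) \<le> p * infsum ?f UNIV"
    using p by (intro mult_left_mono) (auto simp: q_def)
  then show ?thesis using p by (simp add: Upsilon_def q_def)
qed

lemma rho_bar_ge_third: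
  assumes p: "0 < p" "p < 1"
  shows "1 / 3 \<le> rho_bar p"
proof -
  have "exp (1 :: real) \<le> 3" by (rule exp_le)
  then have "1 / 3 \<le> exp (- 1 :: real)"
    by (simp add: exp_minus field_simps)
  also have "\<dots> \<le> Upsilon p 1" by (rule Upsilon_one_ge[OF p])
  \<comment> \<open>The point 1 is outside the open interval, so it is replaced by the equivalent
    point \<open>1 - p\<close>.\<close>
  also have "\<dots> = Upsilon p (1 - p)" using Upsilon_scale[OF p, of 1] by simp
  also have "\<dots> \<le> rho_bar p" by (rule rho_bar_ge_Upsilon) (use p in auto)
  finally show ?thesis .
qed

text \<open>After squaring \<open>r + 1 / 3\<close>, the difference to \<open>r * (1 + r)\<close> is
  \<open>r / 3 - 1 / 9\<close>, which is nonnegative from \<open>r = 1 / 3\<close> on.\<close>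

lemma sqrt_constant_ge:
  assumes "1 / 3 \<le> (r :: real)"
  shows "2 / 3 \<le> 2 * (sqrt (r * (1 + r)) - r)"
proof -
  have "r + 1 / 3 \<le> sqrt (r * (1 + r))"
    by (rule real_le_rsqrt) (use assms in \<open>auto simp: power2_eq_square algebra_simps\<close>)
  then show ?thesis by simp
qed

lemma rho_bar_1: "rho_bar 1 = 0"
  unfolding rho_bar_def
  by (rule Greatest_equality) (auto simp: Upsilon_def intro: exI[of _ "1/2"])

section \<open>The upper bound\<close>

theorem theorem1p21:
  fixes p :: real
  assumes "0 < p" and "p \<le> 1"
  shows "\<exists>g. g \<in> o(\<lambda>n. real n) \<and>
    (\<forall>n. enn2ereal (ungarian_expectation p (Tam n))
          \<le> ereal (2 / p * (sqrt (rho_bar p * (1 + rho_bar p)) - rho_bar p) * real n + g n))"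
proof (cases "p = 1")
  case True
  \<comment> \<open>For \<open>p = 1\<close> the linear coefficient is 0, so the constant function 1
    has to carry the whole bound.\<close>
  have "(\<lambda>_. 1) \<in> o(\<lambda>n. real n)" by real_asymp
  moreover have "enn2ereal (ungarian_expectation p (Tam n)) \<le> ereal 1" for n
  proof -
    have "enn2ereal (ungarian_expectation 1 (Tam n)) \<le> enn2ereal 1"
      using ungarian_expectation_Tam_1 by (simp only: less_eq_ennreal.rep_eq)
    then show ?thesis using True by (simp add: one_ennreal.rep_eq one_ereal_def)
  qed
  ultimately show ?thesis using True by (auto simp: rho_bar_1)
next
  case False
  with assms have p: "0 < p" "p < 1" by auto
  define c where "c = 2 / p * (sqrt (rho_bar p * (1 + rho_bar p)) - rho_bar p)"
  define e where "e n = enn2real (ungarian_expectation p (Tam n))" for n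
  \<comment> \<open>The error is the positive part of the excess over the linear term; it remains to
    show that it is sublinear.\<close>
  define g where "g n = max 0 (e n - c * real n)" for n
  have c: "2 / (3 * p) \<le> c"
  proof -
    have "2 / 3 / p \<le> 2 * (sqrt (rho_bar p * (1 + rho_bar p)) - rho_bar p) / p"
      using p sqrt_constant_ge[OF rho_bar_ge_third[OF p]] by (intro divide_right_mono) auto
    then show ?thesis by (simp add: c_def)
  qed
  \<comment> \<open>Any rate below \<open>p\<close>, here \<open>p / 2\<close>, shows finiteness, so
    passing to real numbers loses nothing.\<close>
  have fin: "ungarian_expectation p (Tam n) = ennreal (e n)" for n
  proof -
    obtain C where "ungarian_expectation p (Tam n) \<le> ennreal (2 / (3 * (p / 2)) * real n + C * (1 + sqrt (real n)))"
      using ungarian_expectation_Tam_bound[of "p / 2" p] p by auto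
    then have "ungarian_expectation p (Tam n) < \<top>"
      by (rule le_less_trans) simp
    then show ?thesis by (simp add: e_def)
  qed
  have "g \<in> o(\<lambda>n. real n)"
  proof (rule landau_o.smallI)
    fix \<delta> :: real assume \<delta>: "\<delta> > 0"
    \<comment> \<open>Chosen so that \<open>2 / (3 * r)\<close> exceeds \<open>2 / (3 * p)\<close>
      by \<open>\<delta> / 2\<close>; the other half of \<open>\<delta>\<close> absorbs the term of
      order \<open>sqrt n\<close>.\<close>
    define r where "r = 1 / (1 / p + 3 * \<delta> / 4)"
    have pos: "1 / p + 3 * \<delta> / 4 > 0" using p \<delta> by (simp add: add_pos_pos)
    have r: "0 < r" "r < p"
    proof -
      show "0 < r" using pos by (simp add: r_def)
      have "1 / (1 / p + 3 * \<delta> / 4) < 1 / (1 / p)"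
        using p \<delta> by (intro divide_strict_left_mono mult_pos_pos pos) auto
      then show "r < p" by (simp add: r_def)
    qed
    have "2 / (3 * r) = 2 / 3 * (1 / r)" by simp
    also have "1 / r = 1 / p + 3 * \<delta> / 4" by (simp add: r_def)
    finally have r_eq: "2 / (3 * r) = 2 / (3 * p) + \<delta> / 2" by (simp add: field_simps)
    obtain C where C: "C \<ge> 0" "\<And>n. ungarian_expectation p (Tam n) \<le>
        ennreal (2 / (3 * r) * real n + C * (1 + sqrt (real n)))"
      using ungarian_expectation_Tam_bound[OF r assms(2)] by blast
    have "(\<lambda>n. 1 + sqrt (real n)) \<in> o(\<lambda>n. real n)" by real_asymp
    then have "(\<lambda>n. C * (1 + sqrt (real n))) \<in> o(\<lambda>n. real n)"
      by (cases "C = 0") simp_all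
    from landau_o.smallD[OF this, of "\<delta> / 2"] \<delta>
    have "eventually (\<lambda>n. C * (1 + sqrt (real n)) \<le> \<delta> / 2 * real n) at_top"
      by (auto elim!: eventually_mono)
    then show "eventually (\<lambda>n. norm (g n) \<le> \<delta> * norm (real n)) at_top"
    proof eventually_elim
      case (elim n)
      have "0 \<le> 2 / (3 * r) * real n + C * (1 + sqrt (real n))"
        using r C(1) by (intro add_nonneg_nonneg mult_nonneg_nonneg) auto
      then have "e n \<le> 2 / (3 * r) * real n + C * (1 + sqrt (real n))"
        using C(2)[of n] unfolding fin by (simp only: ennreal_le_iff)
      moreover have "2 / (3 * p) * real n \<le> c * real n"
        using c by (intro mult_right_mono) auto
      ultimately have "e n - c * real n \<le> \<delta> * real n"
        using elim unfolding r_eq by (simp add: algebra_simps)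
      then show ?case using \<delta> by (simp add: g_def)
    qed
  qed
  moreover have "enn2ereal (ungarian_expectation p (Tam n)) \<le> ereal (c * real n + g n)" for n
    unfolding fin by (simp add: enn2ereal_ennreal e_def g_def)
  ultimately show ?thesis unfolding c_def by blast
qed

end
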